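(* For every fixed integer $k\ge 3$, the limit \[ \gamma_k:=\lim_{N\to\infty}\frac{\log f_k(N)}{\log\log N} \] exists; equivalently, $f_k(N)=(\log N)^{\gamma_k+o(1)}$ as $N\to\infty$. Moreover, \[ \gamma_k=\sup_{\substack{n\ge 1\\ 1\le r\le n}}\frac{r}{en}\,M_k(n,r)^{1/r}, \] where the supremum is over integers $n,r$ and $e$ is the base of the natural logarithm.
   Context: Write $[N]=\{1,\dots,N\}$. A set $A\subseteq[N]$ is LCM-$k$-free if it contains no $k$ distinct integers $a_1,\dots,a_k$ for which $\operatorname{lcm}(a_i,a_j)$ is the same for all pairs $1\le i<j\le k$. Define \[ f_k(N):=\max\Big\{\sum_{a\in A}\frac1a : A\subseteq[N]\text{ is LCM-}k\text{-free}\Big\}. \] Distinct sets $S_1,\dots,S_k$ form a $k$-cosunflower if their pairwise unions $S_i\cup S_j$ ($i\neq j$) are all equal. A family of sets is $k$-cosunflower-free if no $k$ distinct members form a $k$-cosunflower. $\binom{[n]}{r}$ is the family of all $r$-element subsets of $[n]$, and \[ M_k(n,r):=\max\Big\{|\mathcal G| : \mathcal G\subseteq\binom{[n]}{r}\text{ is }k\text{-cosunflower-free}\Big\}. \] *)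

theory Defs
  imports Complex_Main
begin

text \<open>A choice of \<open>k\<close> distinct elements is represented by a \<open>k\<close>-element subset. We only use
  \<open>k \<ge> 3\<close>, where \<open>card B = k\<close> implies that \<open>B\<close> is finite and that it has a pair of distinct
  elements, so the common value below is unique.\<close>

definition lcm_free :: "nat \<Rightarrow> nat set \<Rightarrow> bool" where
  "lcm_free k A \<longleftrightarrow>
     \<not> (\<exists>B\<subseteq>A. card B = k \<and> (\<exists>L. \<forall>a\<in>B. \<forall>b\<in>B. a \<noteq> b \<longrightarrow> lcm a b = L))"

definition f_lcm :: "nat \<Rightarrow> nat \<Rightarrow> real" where
  "f_lcm k N = Max {(\<Sum>a\<in>A. 1 / real a) | A. A \<subseteq> {1..N} \<and> lcm_free k A}"

definition cosunflower :: "nat \<Rightarrow> 'a set set \<Rightarrow> bool" where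
  "cosunflower k F \<longleftrightarrow>
     card F = k \<and> (\<exists>U. \<forall>S\<in>F. \<forall>T\<in>F. S \<noteq> T \<longrightarrow> S \<union> T = U)"

definition cosunflower_free :: "nat \<Rightarrow> 'a set set \<Rightarrow> bool" where
  "cosunflower_free k G \<longleftrightarrow> \<not> (\<exists>F\<subseteq>G. cosunflower k F)"

definition M_cosun :: "nat \<Rightarrow> nat \<Rightarrow> nat \<Rightarrow> nat" where
  "M_cosun k n r = Max {card G | G. G \<subseteq> {S. S \<subseteq> {1..n} \<and> card S = r} \<and> cosunflower_free k G}"

end

theory Submission
  imports Defs "HOL-Library.FuncSet" "HOL-Computational_Algebra.Squarefree"
    "HOL-Analysis.Harmonic_Numbers" "HOL-Real_Asymp.Real_Asymp"
begin

text \<open>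
  Squarefree integers are finite sets of primes, and lcm is union; since every integer is
  \<open>b * d\<^sup>2\<close> with \<open>b\<close> squarefree and \<open>\<Sum>1/d\<^sup>2\<close> converges, the problem is to bound
  \<open>\<Sum>S\<in>B. \<Prod>p\<in>S. 1/p\<close> for cosunflower-free families \<open>B\<close> of sets of primes, where the total mass
  \<open>W = \<Sum>p\<le>N. 1/p\<close> is \<open>(1 + o(1)) ln ln N\<close>. The key fact is that, for \<open>k \<ge> 3\<close>, uniform cosunflower-free
  families pull back along arbitrary maps, restricting to the sets on which the map is injective.

  Upper bound: blowing every prime up into a number of copies proportional to \<open>1/p\<close> compares the
  \<open>t\<close>-uniform part of \<open>B\<close> with \<open>M_cosun k n t\<close> as \<open>n \<rightarrow> \<infinity>\<close> and gives at most
  \<open>(W \<gamma> e / t)\<^sup>t \<le> e\<^bsup>\<gamma> W\<^esup>\<close>; the levels \<open>t > 2 e W\<close> are negligible.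

  Lower bound: given an optimal family \<open>G\<close> for \<open>(n, r)\<close>, split the primes into blocks of \<open>n\<close> classes,
  each class of mass about \<open>\<tau>\<close>. Replacing the points of \<open>G\<close> by the classes of a block gives a family of
  weight \<open>card G * \<tau>\<^sup>r\<close>, and uniformity makes joins over distinct blocks cosunflower-free again. With
  about \<open>W / (n \<tau>)\<close> blocks, the best choice is \<open>\<tau> = e / (card G)\<^bsup>1/r\<^esup>\<close>.
\<close>

section \<open>Cosunflower-free families\<close>

lemma cosunflower_free_subset:
  "cosunflower_free k G \<Longrightarrow> H \<subseteq> G \<Longrightarrow> cosunflower_free k H"
  unfolding cosunflower_free_def by (meson subset_trans)

lemma cosunflower_mem_Un:
  assumes "cosunflower k F" "S \<in> F" "T \<in> F" "S \<noteq> T" "A \<in> F" "B \<in> F" "A \<noteq> B"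
  shows "S \<union> T = A \<union> B"
  using assms unfolding cosunflower_def by metis

lemma card_ge_3_obtain_third:
  assumes "card F \<ge> 3"
  obtains R where "R \<in> F" "R \<noteq> S" "R \<noteq> T"
proof -
  have "finite F" using assms by (metis card.infinite not_numeral_le_zero)
  have "card (F - {S, T}) \<ge> 1"
    using assms diff_card_le_card_Diff[of "{S, T}" F] card_insert_le_m1[of 2 "{T}" S] by simp
  then have "F - {S, T} \<noteq> {}" by force
  then show ?thesis using that by blast
qed

text \<open>Here \<open>\<phi>\<close> respects unions, as images and traces do. If distinct members
  \<open>S\<close> and \<open>T\<close> have the same value, then for every \<open>R\<close> the
  union of the values at \<open>R\<close> and \<open>S\<close> is just the value at
  \<open>S\<close>; uniformity turns the resulting inclusion into equality.\<close>

lemma cosunflower_const_or_inj: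
  assumes F: "cosunflower k F"
    and un: "\<And>S T A B. \<lbrakk>S \<in> F; T \<in> F; A \<in> F; B \<in> F; S \<union> T = A \<union> B\<rbrakk>
              \<Longrightarrow> \<phi> S \<union> \<phi> T = \<phi> A \<union> \<phi> B"
    and fin: "\<And>S. S \<in> F \<Longrightarrow> finite (\<phi> S)"
    and card_eq: "\<And>S. S \<in> F \<Longrightarrow> card (\<phi> S) = r"
  shows "(\<exists>C. \<forall>S\<in>F. \<phi> S = C) \<or> (inj_on \<phi> F \<and> cosunflower k (\<phi> ` F))"
proof (cases "inj_on \<phi> F")
  case True
  obtain U where U: "\<And>S T. \<lbrakk>S \<in> F; T \<in> F; S \<noteq> T\<rbrakk> \<Longrightarrow> S \<union> T = U" and k: "card F = k"
    using F unfolding cosunflower_def by auto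
  have un': "\<phi> S \<union> \<phi> T = \<phi> A \<union> \<phi> B"
    if "S \<in> F" "T \<in> F" "A \<in> F" "B \<in> F" "\<phi> S \<noteq> \<phi> T" "\<phi> A \<noteq> \<phi> B" for S T A B
  proof (rule un)
    show "S \<union> T = A \<union> B" using U[of S T] U[of A B] that by auto
  qed (use that in auto)
  have "\<exists>V. \<forall>P\<in>\<phi> ` F. \<forall>Q\<in>\<phi> ` F. P \<noteq> Q \<longrightarrow> P \<union> Q = V"
  proof (cases "\<exists>S\<in>F. \<exists>T\<in>F. \<phi> S \<noteq> \<phi> T")
    case True
    then obtain S T where "S \<in> F" "T \<in> F" "\<phi> S \<noteq> \<phi> T" by auto
    then have "\<forall>A\<in>F. \<forall>B\<in>F. \<phi> A \<noteq> \<phi> B \<longrightarrow> \<phi> A \<union> \<phi> B = \<phi> S \<union> \<phi> T"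
      by (intro ballI impI un')
    then show ?thesis by (simp only: ball_simps) blast
  next
    case False
    then show ?thesis by (simp only: ball_simps) blast
  qed
  then have "cosunflower k (\<phi> ` F)"
    unfolding cosunflower_def using card_image[OF \<open>inj_on \<phi> F\<close>] k by simp
  then show ?thesis using True by blast
next
  case False
  then obtain S T where ST: "S \<in> F" "T \<in> F" "S \<noteq> T" "\<phi> S = \<phi> T"
    by (auto simp: inj_on_def)
  have "\<phi> R = \<phi> S" if "R \<in> F" for R
  proof -
    have "\<phi> R \<subseteq> \<phi> S"
    proof (cases "R = S")
      case False
      then have "\<phi> R \<union> \<phi> S = \<phi> S \<union> \<phi> T"
        by (intro un cosunflower_mem_Un[OF F]) (use ST that in auto)
      then show ?thesis using ST by auto
    qed auto
    then show ?thesis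
      using card_subset_eq[OF fin[OF ST(1)]] card_eq[OF that] card_eq[OF ST(1)] by auto
  qed
  then show ?thesis by blast
qed

text \<open>By the dichotomy it suffices to exclude that all images coincide. A third member rules
  this out, which is where \<open>k \<ge> 3\<close> enters.\<close>

lemma cosunflower_image:
  assumes k: "k \<ge> 3" and F: "cosunflower k F"
    and fin: "\<And>S. S \<in> F \<Longrightarrow> finite S" and card: "\<And>S. S \<in> F \<Longrightarrow> card S = r"
    and inj: "\<And>S. S \<in> F \<Longrightarrow> inj_on h S"
  shows "cosunflower k ((`) h ` F)"
proof -
  have kF: "card F = k" using F unfolding cosunflower_def by auto
  have "(\<exists>C. \<forall>S\<in>F. h ` S = C) \<or> (inj_on ((`) h) F \<and> cosunflower k ((`) h ` F))"
    by (rule cosunflower_const_or_inj[OF F])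
       (auto simp flip: image_Un simp: fin card_image card inj)
  moreover have False if C: "\<forall>S\<in>F. h ` S = C" for C
  proof -
    obtain S where S: "S \<in> F" using card_ge_3_obtain_third[of F] kF k by metis
    obtain T where T: "T \<in> F" "T \<noteq> S" using card_ge_3_obtain_third[of F S] kF k by metis
    obtain R where R: "R \<in> F" "R \<noteq> S" "R \<noteq> T"
      using card_ge_3_obtain_third[of F S T] kF k by metis
    have "\<not> S \<subseteq> T" using card_subset_eq[OF fin[OF T(1)]] card S T by metis
    \<comment> \<open>The image of \<open>p\<close> is also hit by some \<open>q\<close> in
      \<open>T\<close>, and \<open>q\<close> is outside \<open>S\<close> by injectivity there. Equal
      unions force both \<open>p\<close> and \<open>q\<close> into the third member
      \<open>R\<close>, where \<open>h\<close> would identify them.\<close>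
    then obtain p where p: "p \<in> S" "p \<notin> T" by auto
    have "h p \<in> h ` T" using C S T p by blast
    then obtain q where q: "q \<in> T" "h q = h p" by auto
    have "q \<notin> S" using inj[OF S] p q by (metis inj_onD)
    have "S \<union> T = R \<union> T" "S \<union> T = R \<union> S"
      using cosunflower_mem_Un[OF F] S T R by metis+
    then have "p \<in> R" "q \<in> R" using p q \<open>q \<notin> S\<close> by auto
    then show False using inj[OF R(1)] p q by (metis inj_onD)
  qed
  ultimately show ?thesis by blast
qed

text \<open>The blow-up of \<open>G\<close>: each point is replaced by its fibre in
  \<open>X\<close>, and a member takes one element from each fibre over a set of \<open>G\<close>.
  Injectivity preserves cardinalities.\<close>

definition pullback :: "('a \<Rightarrow> 'b) \<Rightarrow> 'a set \<Rightarrow> 'b set set \<Rightarrow> 'a set set" where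
  "pullback h X G = {S. S \<subseteq> X \<and> inj_on h S \<and> h ` S \<in> G}"

lemma card_pullback_mem:
  assumes "\<And>S. S \<in> G \<Longrightarrow> card S = r" "S \<in> pullback h X G"
  shows "card S = r"
  using assms card_image[of h S] unfolding pullback_def by fastforce

lemma cosunflower_free_pullback:
  assumes k: "k \<ge> 3" and fin: "finite X" and card: "\<And>S. S \<in> G \<Longrightarrow> card S = r"
    and free: "cosunflower_free k G"
  shows "cosunflower_free k (pullback h X G)"
  unfolding cosunflower_free_def
proof (intro notI, elim exE conjE)
  fix F assume F: "F \<subseteq> pullback h X G" "cosunflower k F"
  have mem: "S \<subseteq> X" "inj_on h S" "card S = r" if "S \<in> F" for S
    using F(1) that card_pullback_mem[OF card, where S = S and h = h and X = X] by (auto simp: pullback_def)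
  have "cosunflower k ((`) h ` F)"
    by (rule cosunflower_image[OF k F(2), of r]) (use mem fin in \<open>auto intro: finite_subset\<close>)
  moreover have "(`) h ` F \<subseteq> G" using F(1) by (auto simp: pullback_def)
  ultimately show False using free unfolding cosunflower_free_def by blast
qed

text \<open>A member of the pullback amounts to a set \<open>T\<close> of \<open>G\<close> with a
  choice of one element from each fibre over \<open>T\<close>, so expanding the product of sums
  lists exactly these members.\<close>

lemma sum_pullback_prod:
  fixes w :: "'a \<Rightarrow> 'c::comm_semiring_1"
  assumes finX: "finite X" and finG: "finite G" and fin: "\<And>S. S \<in> G \<Longrightarrow> finite S"
  shows "(\<Sum>S\<in>pullback h X G. \<Prod>x\<in>S. w x) = (\<Sum>T\<in>G. \<Prod>i\<in>T. \<Sum>x\<in>{x\<in>X. h x = i}. w x)"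
proof -
  let ?B = "\<lambda>i. {x\<in>X. h x = i}"
  have "(\<Sum>T\<in>G. \<Prod>i\<in>T. \<Sum>x\<in>?B i. w x) = (\<Sum>T\<in>G. \<Sum>g\<in>PiE T ?B. \<Prod>i\<in>T. w (g i))"
    using finX fin by (intro sum.cong refl prod_sum_PiE) auto
  also have "\<dots> = (\<Sum>(T, g)\<in>Sigma G (\<lambda>T. PiE T ?B). \<Prod>i\<in>T. w (g i))"
    using finX finG fin by (intro sum.Sigma) (auto intro!: finite_PiE)
  \<comment> \<open>A choice function corresponds to its range; the way back is the inverse of
    \<open>h\<close> on \<open>S\<close>, made extensional by \<open>restrict\<close> as
    \<open>PiE\<close> demands.\<close>
  also have "\<dots> = (\<Sum>S\<in>pullback h X G. \<Prod>x\<in>S. w x)"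
  proof (rule sum.reindex_bij_witness[of _ "\<lambda>S. (h ` S, restrict (inv_into S h) (h ` S))"
        "\<lambda>(T, g). g ` T"])
    fix a assume "a \<in> Sigma G (\<lambda>T. PiE T ?B)"
    then obtain T g where a: "a = (T, g)" "T \<in> G" "g \<in> PiE T ?B" by auto
    have g: "g i \<in> X" "h (g i) = i" if "i \<in> T" for i using a that by auto
    have injg: "inj_on g T" using g by (metis inj_onI)
    have himg: "h ` g ` T = T" using g by force
    have injh: "inj_on h (g ` T)" using g by (auto simp: inj_on_def)
    have "restrict (inv_into (g ` T) h) T = g"
    proof
      fix i show "restrict (inv_into (g ` T) h) T i = g i"
      proof (cases "i \<in> T")
        case True
        then show ?thesis using inv_into_f_eq[OF injh, of "g i" i] g by simp
      next
        case False
        then show ?thesis using PiE_arb[OF a(3)] by simp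
      qed
    qed
    then show "(\<lambda>S. (h ` S, restrict (inv_into S h) (h ` S))) (case a of (T, g) \<Rightarrow> g ` T) = a"
      using a himg by simp
    show "(case a of (T, g) \<Rightarrow> g ` T) \<in> pullback h X G"
      using a g himg injh by (auto simp: pullback_def)
    show "prod w (case a of (T, g) \<Rightarrow> g ` T) = (case a of (T, g) \<Rightarrow> \<Prod>i\<in>T. w (g i))"
      using a injg by (simp add: prod.reindex)
  next
    fix S assume S: "S \<in> pullback h X G"
    then have inj: "inj_on h S" by (simp add: pullback_def)
    have "restrict (inv_into S h) (h ` S) ` h ` S = S"
      using inj by (force simp: image_iff)
    then show "(case (h ` S, restrict (inv_into S h) (h ` S)) of (T, g) \<Rightarrow> g ` T) = S" by simp
    show "(h ` S, restrict (inv_into S h) (h ` S)) \<in> Sigma G (\<lambda>T. PiE T ?B)"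
      using S inj by (auto simp: pullback_def)
  qed
  finally show ?thesis ..
qed

lemma sum_prod_Un_disjoint:
  fixes w :: "'a \<Rightarrow> 'c::comm_semiring_1"
  assumes fin: "finite X" "finite Y" and disj: "X \<inter> Y = {}" and sub: "F \<subseteq> Pow X" "G \<subseteq> Pow Y"
  shows "(\<Sum>S\<in>(\<lambda>(S, T). S \<union> T) ` (F \<times> G). \<Prod>x\<in>S. w x) =
    (\<Sum>S\<in>F. \<Prod>x\<in>S. w x) * (\<Sum>S\<in>G. \<Prod>x\<in>S. w x)"
proof -
  have ST: "(S \<union> T) \<inter> X = S" "(S \<union> T) \<inter> Y = T" if "S \<in> F" "T \<in> G" for S T
    using sub disj that by blast+
  have "(\<Sum>S\<in>(\<lambda>(S, T). S \<union> T) ` (F \<times> G). \<Prod>x\<in>S. w x) =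
      (\<Sum>(S, T)\<in>F \<times> G. \<Prod>x\<in>S \<union> T. w x)"
  proof (subst sum.reindex)
    show "inj_on (\<lambda>(S, T). S \<union> T) (F \<times> G)"
    proof (rule inj_onI, clarify)
      fix S T S' T' assume mem: "S \<in> F" "T \<in> G" "S' \<in> F" "T' \<in> G" and eq: "S \<union> T = S' \<union> T'"
      show "S = S' \<and> T = T'" using ST[OF mem(1,2)] ST[OF mem(3,4)] unfolding eq by simp
    qed
  qed (simp add: case_prod_unfold)
  also have "\<dots> = (\<Sum>(S, T)\<in>F \<times> G. (\<Prod>x\<in>S. w x) * (\<Prod>x\<in>T. w x))"
  proof (intro sum.cong refl, clarify)
    fix S T assume "S \<in> F" "T \<in> G"
    then have "S \<subseteq> X" "T \<subseteq> Y" using sub by auto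
    then show "prod w (S \<union> T) = prod w S * prod w T"
      using disj fin by (intro prod.union_disjoint) (auto intro: finite_subset)
  qed
  also have "\<dots> = (\<Sum>S\<in>F. \<Prod>x\<in>S. w x) * (\<Sum>S\<in>G. \<Prod>x\<in>S. w x)"
    by (simp add: sum_product sum.cartesian_product)
  finally show ?thesis .
qed

text \<open>The traces on \<open>X\<close> and on \<open>Y\<close> respect unions, so on a
  cosunflower each is constant or yields a cosunflower in \<open>F\<close> or \<open>G\<close>. The
  latter is excluded, and two constant traces would make all members equal.\<close>

lemma cosunflower_free_join:
  assumes k: "k \<ge> 3" and fin: "finite X" "finite Y" and disj: "X \<inter> Y = {}"
    and sub: "F \<subseteq> Pow X" "G \<subseteq> Pow Y"
    and card: "\<And>S. S \<in> F \<Longrightarrow> card S = r" "\<And>S. S \<in> G \<Longrightarrow> card S = s"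
    and free: "cosunflower_free k F" "cosunflower_free k G"
  shows "cosunflower_free k ((\<lambda>(S, T). S \<union> T) ` (F \<times> G))"
  unfolding cosunflower_free_def
proof (intro notI, elim exE conjE)
  fix H assume H: "H \<subseteq> (\<lambda>(S, T). S \<union> T) ` (F \<times> G)" "cosunflower k H"
  have kH: "card H = k" using H unfolding cosunflower_def by auto
  have inF: "R \<inter> X \<in> F" and inG: "R \<inter> Y \<in> G" and Req: "R = (R \<inter> X) \<union> (R \<inter> Y)" if R: "R \<in> H" for R
  proof -
    obtain S T where ST: "S \<in> F" "T \<in> G" "R = S \<union> T" using H(1) R by auto
    then have "S \<subseteq> X" "T \<subseteq> Y" using sub by auto
    then have "R \<inter> X = S" "R \<inter> Y = T" using ST disj by auto
    then show "R \<inter> X \<in> F" "R \<inter> Y \<in> G" "R = (R \<inter> X) \<union> (R \<inter> Y)" using ST by auto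
  qed
  have "(\<exists>C. \<forall>S\<in>H. S \<inter> X = C) \<or> (inj_on (\<lambda>S. S \<inter> X) H \<and> cosunflower k ((\<lambda>S. S \<inter> X) ` H))"
    by (rule cosunflower_const_or_inj[OF H(2), where r = r])
       (use fin in \<open>auto simp: card inF simp flip: Int_Un_distrib2\<close>)
  moreover have "\<not> cosunflower k ((\<lambda>S. S \<inter> X) ` H)"
    using inF free(1) image_subsetI[of H "\<lambda>S. S \<inter> X" F] unfolding cosunflower_free_def by simp
  ultimately obtain C where C: "\<And>S. S \<in> H \<Longrightarrow> S \<inter> X = C"
    by metis
  have "(\<exists>C. \<forall>S\<in>H. S \<inter> Y = C) \<or> (inj_on (\<lambda>S. S \<inter> Y) H \<and> cosunflower k ((\<lambda>S. S \<inter> Y) ` H))"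
    by (rule cosunflower_const_or_inj[OF H(2), where r = s])
       (use fin in \<open>auto simp: card inG simp flip: Int_Un_distrib2\<close>)
  moreover have "\<not> cosunflower k ((\<lambda>S. S \<inter> Y) ` H)"
    using inG free(2) image_subsetI[of H "\<lambda>S. S \<inter> Y" G] unfolding cosunflower_free_def by simp
  ultimately obtain D where D: "\<And>S. S \<in> H \<Longrightarrow> S \<inter> Y = D"
    by metis
  obtain S where S: "S \<in> H" using card_ge_3_obtain_third[of H] kH k by metis
  obtain T where T: "T \<in> H" "T \<noteq> S" using card_ge_3_obtain_third[of H S] kH k by metis
  show False using C D S T Req by metis
qed

section \<open>The extremal number \<open>M_cosun\<close>\<close>

lemma M_cosun_finite:
  "finite {card G | G. G \<subseteq> {S. S \<subseteq> {1..n::nat} \<and> card S = r} \<and> cosunflower_free k G}"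
proof -
  have "finite (Pow {S. S \<subseteq> {1..n::nat} \<and> card S = r})" by simp
  then have "finite (card ` Pow {S. S \<subseteq> {1..n::nat} \<and> card S = r})" by blast
  then show ?thesis by (rule finite_subset[rotated]) auto
qed

lemma cosunflower_free_empty: "k > 0 \<Longrightarrow> cosunflower_free k {}"
  by (auto simp: cosunflower_free_def cosunflower_def)

lemma M_cosun_attained:
  assumes "k > 0"
  obtains G where "G \<subseteq> {S. S \<subseteq> {1..n::nat} \<and> card S = r}" "cosunflower_free k G"
    "card G = M_cosun k n r"
proof -
  have "M_cosun k n r \<in>
      {card G | G. G \<subseteq> {S. S \<subseteq> {1..n::nat} \<and> card S = r} \<and> cosunflower_free k G}"
    unfolding M_cosun_def
    by (rule Max_in[OF M_cosun_finite]) (use cosunflower_free_empty[OF assms] in blast)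
  then show ?thesis using that by auto
qed

lemma card_le_M_cosun_atLeastAtMost:
  assumes "G \<subseteq> {S. S \<subseteq> {1..n::nat} \<and> card S = r}" "cosunflower_free k G"
  shows "card G \<le> M_cosun k n r"
  unfolding M_cosun_def by (rule Max_ge[OF M_cosun_finite]) (use assms in blast)

lemma card_le_M_cosun:
  assumes k: "k \<ge> 3" and fin: "finite X" and n: "card X \<le> n"
    and sub: "G \<subseteq> Pow X" and card: "\<And>S. S \<in> G \<Longrightarrow> card S = r" and free: "cosunflower_free k G"
  shows "card G \<le> M_cosun k n r"
proof -
  obtain e where e: "e ` X \<subseteq> {1..n}" "inj_on e X"
    using card_le_inj[of X "{1..n}"] fin n by auto
  let ?H = "(`) e ` G"
  have inv: "inv_into X e ` e ` S = S" if "S \<in> G" for S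
    using that sub e(2) by (intro inv_into_image_cancel) auto
  have cardH: "card T = r" if "T \<in> ?H" for T
  proof -
    obtain S where S: "S \<in> G" "T = e ` S" using \<open>T \<in> ?H\<close> by auto
    then have "inj_on e S" using sub e(2) by (meson Pow_iff inj_on_subset subsetD)
    then show ?thesis using S card card_image by metis
  qed
  \<comment> \<open>The relabelled family sits inside a pullback along the inverse of the injection,
    so its freeness comes from the pullback lemma.\<close>
  have "?H \<subseteq> pullback (inv_into X e) {1..n} G"
    unfolding pullback_def
  proof (clarify, intro conjI)
    fix S assume S: "S \<in> G"
    show "e ` S \<subseteq> {1..n}" using S sub e by auto
    show "inj_on (inv_into X e) (e ` S)"
      using S sub e by (intro inj_on_inv_into) auto
    show "inv_into X e ` e ` S \<in> G" using inv S by simp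
  qed
  then have "cosunflower_free k ?H"
    using cosunflower_free_pullback[OF k, of "{1..n}" G r] card free
    by (meson cosunflower_free_subset finite_atLeastAtMost)
  moreover have "?H \<subseteq> {S. S \<subseteq> {1..n} \<and> card S = r}"
    using cardH \<open>?H \<subseteq> pullback (inv_into X e) {1..n} G\<close> unfolding pullback_def by blast
  ultimately have "card ?H \<le> M_cosun k n r" by (rule card_le_M_cosun_atLeastAtMost[rotated])
  moreover have "inj_on ((`) e) G" using inv by (metis inj_onI)
  ultimately show ?thesis by (simp add: card_image)
qed

lemma M_cosun_pos:
  assumes "k \<ge> 3" "r \<le> n"
  shows "M_cosun k n r > 0"
proof -
  have "cosunflower_free k {{1..r}}"
    unfolding cosunflower_free_def cosunflower_def
    using assms card_mono[of "{{1..r}}"] by fastforce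
  then have "card {{1..r}} \<le> M_cosun k n r"
    using assms by (intro card_le_M_cosun_atLeastAtMost) auto
  then show ?thesis by simp
qed

lemma M_cosun_le_binomial:
  assumes "k > 0"
  shows "M_cosun k n r \<le> n choose r"
proof -
  obtain G where "G \<subseteq> {S. S \<subseteq> {1..n} \<and> card S = r}" "card G = M_cosun k n r"
    using M_cosun_attained[OF assms, of n r] by metis
  moreover have "finite {S. S \<subseteq> {1..n} \<and> card S = r}" by simp
  ultimately have "M_cosun k n r \<le> card {S. S \<subseteq> {1..n} \<and> card S = r}"
    by (metis card_mono)
  then show ?thesis using n_subsets[of "{1..n}" r] by simp
qed

section \<open>Squarefree integers as sets of primes\<close>

lemma prime_factors_prod_primes:
  fixes S :: "nat set"
  assumes "finite S" "\<And>p. p \<in> S \<Longrightarrow> prime p"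
  shows "prime_factors (\<Prod>S) = S"
proof -
  have "0 \<notin> S" using assms(2) by force
  then have "prime_factors (prod (\<lambda>x. x) S) = \<Union> ((prime_factors \<circ> (\<lambda>x. x)) ` S)"
    using assms(1) by (intro prime_factors_prod) auto
  also have "\<dots> = S" using assms(2) by (auto simp: prime_factorization_prime)
  finally show ?thesis .
qed

lemma prod_primes_pos:
  fixes S :: "nat set"
  assumes "\<And>p. p \<in> S \<Longrightarrow> prime p"
  shows "\<Prod>S > 0"
  using assms prime_gt_0_nat by (intro prod_pos) auto

lemma squarefree_eq_prod_prime_factors:
  fixes n :: nat
  assumes "squarefree n"
  shows "\<Prod>(prime_factors n) = n"
proof -
  have "n > 0" using assms by (cases "n = 0") auto
  have "(\<Prod>p\<in>prime_factors n. p ^ multiplicity p n) = \<Prod>(prime_factors n)"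
    using assms \<open>n > 0\<close> squarefree_factorial_semiring'[of n] by (intro prod.cong) auto
  then show ?thesis using prime_factorization_nat[OF \<open>n > 0\<close>] by simp
qed

text \<open>The union splits into \<open>S\<close> and \<open>T - S\<close>, whose products are
  coprime and both divide the lcm.\<close>

lemma lcm_prod_primes:
  fixes S T :: "nat set"
  assumes fin: "finite S" "finite T" and prime: "\<And>p. p \<in> S \<union> T \<Longrightarrow> prime p"
  shows "lcm (\<Prod>S) (\<Prod>T) = \<Prod>(S \<union> T)"
proof (rule dvd_antisym)
  show "lcm (\<Prod>S) (\<Prod>T) dvd \<Prod>(S \<union> T)"
    using fin by (intro lcm_least prod_dvd_prod_subset) auto
  have "\<Prod>(S \<union> T) = \<Prod>S * \<Prod>(T - S)"
    using fin by (metis Diff_disjoint Un_Diff_cancel finite_Diff prod.union_disjoint)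
  moreover have "coprime (\<Prod>S) (\<Prod>(T - S))"
    using prime by (intro prod_coprime_left prod_coprime_right primes_coprime) auto
  moreover have "\<Prod>(T - S) dvd lcm (\<Prod>S) (\<Prod>T)"
    using fin by (meson Diff_subset dvd_lcm2 dvd_trans prod_dvd_prod_subset)
  ultimately show "\<Prod>(S \<union> T) dvd lcm (\<Prod>S) (\<Prod>T)"
    by (simp add: divides_mult)
qed

lemma inj_on_prod_primes:
  assumes "\<And>S. S \<in> F \<Longrightarrow> finite S \<and> (\<forall>p\<in>S. prime (p::nat))"
  shows "inj_on (\<lambda>S. \<Prod>S) F"
proof (rule inj_onI)
  fix S T assume "S \<in> F" "T \<in> F" "\<Prod>S = \<Prod>T"
  then show "S = T" using assms prime_factors_prod_primes[of S] prime_factors_prod_primes[of T] by metis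
qed

lemma inj_on_prime_factors: "inj_on prime_factors {n::nat. squarefree n}"
  by (rule inj_onI) (metis mem_Collect_eq squarefree_eq_prod_prime_factors)

text \<open>A common lcm \<open>L\<close> forces every pairwise union to be the set of prime factors
  of \<open>L\<close>, and products of distinct sets of primes are distinct.\<close>

lemma lcm_free_prod_image:
  assumes F: "\<And>S. S \<in> F \<Longrightarrow> finite S \<and> (\<forall>p\<in>S. prime (p::nat))" and free: "cosunflower_free k F"
  shows "lcm_free k ((\<lambda>S. \<Prod>S) ` F)"
  unfolding lcm_free_def
proof (intro notI, elim exE conjE)
  fix B L assume B: "B \<subseteq> (\<lambda>S. \<Prod>S) ` F" "card B = k"
    and L: "\<forall>a\<in>B. \<forall>b\<in>B. a \<noteq> b \<longrightarrow> lcm a b = L"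
  obtain H where H: "H \<subseteq> F" "B = (\<lambda>S. \<Prod>S) ` H" using B(1) by (meson subset_imageE)
  have "card H = k"
    using card_image[OF inj_on_subset[OF inj_on_prod_primes[OF F] H(1)]] H(2) B(2) by simp
  moreover have "S \<union> T = prime_factors L" if ST: "S \<in> H" "T \<in> H" "S \<noteq> T" for S T
  proof -
    have mem: "S \<in> F" "T \<in> F" using ST H(1) by auto
    have "\<Prod>S \<noteq> \<Prod>T" using inj_on_prod_primes[of F] F mem ST(3) by (auto dest: inj_onD)
    then have "L = lcm (\<Prod>S) (\<Prod>T)" using L ST H(2) by auto
    also have "\<dots> = \<Prod>(S \<union> T)" using F mem by (intro lcm_prod_primes) auto
    finally show ?thesis using F mem prime_factors_prod_primes[of "S \<union> T"] by auto
  qed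
  ultimately have "cosunflower k H" unfolding cosunflower_def by blast
  then show False using free H(1) unfolding cosunflower_free_def by blast
qed

text \<open>Multiplication by the fixed square \<open>d\<^sup>2\<close> scales every lcm by that
  square, so a cosunflower of prime sets would produce \<open>k\<close> members of \<open>A\<close>
  with a common lcm.\<close>

lemma cosunflower_free_prime_factors:
  fixes A :: "nat set"
  assumes free: "lcm_free k A" and d: "d > 0"
  shows "cosunflower_free k (prime_factors ` {b. squarefree b \<and> b * d\<^sup>2 \<in> A})"
  unfolding cosunflower_free_def
proof (intro notI, elim exE conjE)
  fix F assume "F \<subseteq> prime_factors ` {b. squarefree b \<and> b * d\<^sup>2 \<in> A}" and cos: "cosunflower k F"
  then obtain B where B: "B \<subseteq> {b. squarefree b \<and> b * d\<^sup>2 \<in> A}" "F = prime_factors ` B"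
    by (meson subset_imageE)
  have "inj_on prime_factors B" by (rule inj_on_subset[OF inj_on_prime_factors]) (use B in auto)
  obtain U where U: "\<And>S T. \<lbrakk>S \<in> F; T \<in> F; S \<noteq> T\<rbrakk> \<Longrightarrow> S \<union> T = U"
    and cF: "card F = k" using cos unfolding cosunflower_def by auto
  have "inj_on (\<lambda>b. b * d\<^sup>2) B" using d by (auto simp: inj_on_def)
  then have "card ((\<lambda>b. b * d\<^sup>2) ` B) = k"
    using card_image[OF \<open>inj_on prime_factors B\<close>] cF B(2) by (simp add: card_image)
  moreover have "lcm (b * d\<^sup>2) (c * d\<^sup>2) = \<Prod>U * d\<^sup>2" if bc: "b \<in> B" "c \<in> B" "b \<noteq> c" for b c
  proof -
    have "prime_factors b \<noteq> prime_factors c"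
      using \<open>inj_on prime_factors B\<close> bc by (auto dest: inj_onD)
    then have un: "prime_factors b \<union> prime_factors c = U" using U bc B(2) by auto
    have "lcm b c = lcm (\<Prod>(prime_factors b)) (\<Prod>(prime_factors c))"
      using bc B(1) squarefree_eq_prod_prime_factors by (metis (no_types, lifting) mem_Collect_eq subsetD)
    also have "\<dots> = \<Prod>U"
      unfolding un[symmetric] by (intro lcm_prod_primes) auto
    finally show ?thesis using lcm_mult_right[of b "d\<^sup>2" c] by (simp add: lcm.commute)
  qed
  ultimately have "card ((\<lambda>b. b * d\<^sup>2) ` B) = k \<and>
      (\<exists>L. \<forall>a\<in>(\<lambda>b. b * d\<^sup>2) ` B. \<forall>b\<in>(\<lambda>b. b * d\<^sup>2) ` B. a \<noteq> b \<longrightarrow> lcm a b = L)"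
    by blast
  moreover have "(\<lambda>b. b * d\<^sup>2) ` B \<subseteq> A" using B(1) by auto
  ultimately show False using free unfolding lcm_free_def by blast
qed

section \<open>Reciprocal sums and splitting off square factors\<close>

lemma prod_inverse_eq:
  fixes S :: "nat set"
  shows "(\<Prod>p\<in>S. 1 / real p) = 1 / real (\<Prod>S)"
  by (simp add: prod_dividef)

lemma sum_inverse_squarefree_eq:
  fixes B :: "nat set"
  assumes "B \<subseteq> {b. squarefree b}"
  shows "(\<Sum>b\<in>B. 1 / real b) = (\<Sum>S\<in>prime_factors ` B. \<Prod>p\<in>S. 1 / real p)"
proof (subst sum.reindex)
  show "inj_on prime_factors B" by (rule inj_on_subset[OF inj_on_prime_factors assms])
  show "(\<Sum>b\<in>B. 1 / real b) = sum ((\<lambda>S. \<Prod>p\<in>S. 1 / real p) \<circ> prime_factors) B"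
    unfolding prod_inverse_eq comp_def
    by (intro sum.cong refl) (metis assms mem_Collect_eq squarefree_eq_prod_prime_factors subsetD)
qed

lemma sum_inverse_squares_le: "(\<Sum>d=1..N. 1 / (real d)\<^sup>2) \<le> 2"
proof -
  \<comment> \<open>Strengthened so that the induction telescopes.\<close>
  have "(\<Sum>d=1..Suc n. 1 / (real d)\<^sup>2) \<le> 2 - 1 / real (Suc n)" for n
  proof (induction n)
    case (Suc n)
    have "1 / (real (Suc (Suc n)))\<^sup>2 \<le> 1 / (real (Suc n) * real (Suc (Suc n)))"
      by (intro divide_left_mono) (auto simp: power2_eq_square intro!: mult_right_mono)
    also have "\<dots> = 1 / real (Suc n) - 1 / real (Suc (Suc n))" by (simp add: field_simps)
    finally show ?case using Suc by simp
  qed simp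
  then have "(\<Sum>d=1..Suc n. 1 / (real d)\<^sup>2) \<le> 2" for n
    by (smt (verit) divide_nonneg_nonneg of_nat_0_le_iff)
  then show ?thesis by (cases N) auto
qed

text \<open>Write each \<open>a\<close> as \<open>b * d\<^sup>2\<close> with \<open>b\<close>
  squarefree and sort by \<open>d\<close>: the part with given \<open>d\<close> contributes at most
  \<open>C / d\<^sup>2\<close>. This serves both for \<open>f_lcm\<close> and, with
  \<open>A = {1..N}\<close>, for the harmonic sum.\<close>

lemma sum_inverse_le_squarefree:
  fixes A :: "nat set"
  assumes A: "A \<subseteq> {1..N}" and C: "C \<ge> 0"
    and bound: "\<And>d. d > 0 \<Longrightarrow> (\<Sum>b\<in>{b\<in>{1..N}. squarefree b \<and> b * d\<^sup>2 \<in> A}. 1 / real b) \<le> C"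
  shows "(\<Sum>a\<in>A. 1 / real a) \<le> 2 * C"
proof -
  have fin: "finite A" using A finite_subset by blast
  have dec: "a = squarefree_part a * (square_part a)\<^sup>2" for a :: nat
    by (rule squarefree_decompose)
  have pos: "a > 0" "square_part a > 0" "squarefree_part a > 0" if "a \<in> A" for a
    using A that by (auto simp: square_part_0_iff intro!: Nat.gr0I)
  have le: "squarefree_part a \<le> a" "square_part a \<le> a" if "a \<in> A" for a
  proof -
    have "squarefree_part a dvd a" "square_part a dvd a"
      by (subst (2) dec, simp)+
    then show "squarefree_part a \<le> a" "square_part a \<le> a" using pos[OF that] by (auto intro: dvd_imp_le)
  qed
  have "(\<Sum>a\<in>A. 1 / real a) = (\<Sum>d=1..N. \<Sum>a\<in>{a\<in>A. square_part a = d}. 1 / real a)"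
    using fin A pos le by (intro sum.group[symmetric]) (fastforce simp: Suc_le_eq)+
  also have "\<dots> \<le> (\<Sum>d=1..N. 1 / (real d)\<^sup>2 * C)"
  proof (rule sum_mono)
    fix d assume d: "d \<in> {1..N}"
    let ?A = "{a\<in>A. square_part a = d}"
    have "(\<Sum>a\<in>?A. 1 / real a) = (\<Sum>a\<in>?A. 1 / (real d)\<^sup>2 * (1 / real (squarefree_part a)))"
    proof (intro sum.cong refl)
      fix a assume "a \<in> ?A"
      then have "real a = real (squarefree_part a) * (real d)\<^sup>2"
        using dec[of a] by (metis (mono_tags, lifting) mem_Collect_eq of_nat_mult of_nat_power)
      then show "1 / real a = 1 / (real d)\<^sup>2 * (1 / real (squarefree_part a))" by simp
    qed
    also have "\<dots> = 1 / (real d)\<^sup>2 * (\<Sum>b\<in>squarefree_part ` ?A. 1 / real b)"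
    proof -
      have "inj_on squarefree_part ?A"
        using dec by (intro inj_onI) (metis (mono_tags, lifting) mem_Collect_eq)
      then show ?thesis by (simp add: sum.reindex sum_distrib_left)
    qed
    also have "\<dots> \<le> 1 / (real d)\<^sup>2 * C"
    proof (intro mult_left_mono)
      have "squarefree_part ` ?A \<subseteq> {b\<in>{1..N}. squarefree b \<and> b * d\<^sup>2 \<in> A}"
      proof clarify
        fix a assume a: "a \<in> A" "d = square_part a"
        have "squarefree_part a * (square_part a)\<^sup>2 \<in> A" using a dec[of a] by metis
        then show "squarefree_part a \<in> {1..N} \<and> squarefree (squarefree_part a) \<and>
            squarefree_part a * (square_part a)\<^sup>2 \<in> A"
          using a A le(1)[of a] pos(3)[of a] by auto
      qed
      then have "(\<Sum>b\<in>squarefree_part ` ?A. 1 / real b) \<le>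
          (\<Sum>b\<in>{b\<in>{1..N}. squarefree b \<and> b * d\<^sup>2 \<in> A}. 1 / real b)"
        by (intro sum_mono2) auto
      then show "(\<Sum>b\<in>squarefree_part ` ?A. 1 / real b) \<le> C" using bound[of d] d by auto
    qed auto
    finally show "(\<Sum>a\<in>?A. 1 / real a) \<le> 1 / (real d)\<^sup>2 * C" .
  qed
  also have "\<dots> = (\<Sum>d=1..N. 1 / (real d)\<^sup>2) * C" by (simp add: sum_distrib_right)
  also have "\<dots> \<le> 2 * C" using C by (intro mult_right_mono sum_inverse_squares_le)
  finally show ?thesis .
qed

section \<open>Sums of reciprocals of primes\<close>

definition primes_upto :: "nat \<Rightarrow> nat set" where
  "primes_upto N = {p. prime p \<and> p \<le> N}"

definition prime_recip_sum :: "nat \<Rightarrow> real" where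
  "prime_recip_sum N = (\<Sum>p\<in>primes_upto N. 1 / real p)"

lemma finite_primes_upto [simp]: "finite (primes_upto N)"
  unfolding primes_upto_def by simp

lemma prime_recip_sum_nonneg: "prime_recip_sum N \<ge> 0"
  unfolding prime_recip_sum_def by (intro sum_nonneg) auto

lemma prime_factors_subset_primes_upto:
  assumes "b \<in> {1..N}"
  shows "prime_factors b \<subseteq> primes_upto N"
proof
  fix p assume "p \<in> prime_factors b"
  then have "prime p" "p dvd b" "b > 0" using assms by auto
  then show "p \<in> primes_upto N" using dvd_imp_le[of p b] assms by (auto simp: primes_upto_def)
qed

text \<open>Euler's lower bound for the prime mass, at least \<open>ln (ln (N + 1)) - ln 2\<close>:
  the harmonic sum exceeds the logarithm, while its squarefree part is at most the product of the
  factors \<open>1 + 1/p\<close>.\<close>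

lemma ln_le_exp_prime_recip_sum: "ln (real N + 1) \<le> 2 * exp (prime_recip_sum N)"
proof -
  have "(\<Sum>a\<in>{1..N}. 1 / real a) \<le> 2 * exp (prime_recip_sum N)"
  proof (rule sum_inverse_le_squarefree)
    fix d :: nat assume "d > 0"
    let ?B = "{b\<in>{1..N}. squarefree b \<and> b * d\<^sup>2 \<in> {1..N}}"
    have "(\<Sum>b\<in>?B. 1 / real b) = (\<Sum>S\<in>prime_factors ` ?B. \<Prod>p\<in>S. 1 / real p)"
      by (rule sum_inverse_squarefree_eq) blast
    also have "\<dots> \<le> (\<Sum>S\<in>Pow (primes_upto N). \<Prod>p\<in>S. 1 / real p)"
      using prime_factors_subset_primes_upto[of _ N]
      by (intro sum_mono2) (auto intro!: prod_nonneg simp del: in_prime_factors_iff)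
    also have "\<dots> = (\<Prod>p\<in>primes_upto N. 1 / real p + 1)"
      by (simp add: prod_add)
    also have "\<dots> \<le> (\<Prod>p\<in>primes_upto N. exp (1 / real p))"
      using exp_ge_add_one_self by (intro prod_mono) (auto simp: add.commute)
    also have "\<dots> = exp (prime_recip_sum N)"
      unfolding prime_recip_sum_def by (simp add: exp_sum)
    finally show "(\<Sum>b\<in>?B. 1 / real b) \<le> exp (prime_recip_sum N)" .
  qed auto
  then show ?thesis using ln_le_harm[of N] by (simp add: harm_def inverse_eq_divide)
qed

text \<open>Partial sums of the zeta function at \<open>1 + t\<close>. The mean value theorem
  supplies the telescoping comparison usually made with an integral.\<close>

lemma sum_powr_le:
  fixes t :: real
  assumes t: "t > 0"
  shows "(\<Sum>n=1..K. real n powr (-1 - t)) \<le> 1 + 1 / t"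
proof -
  have "(\<Sum>n=1..Suc K. real n powr (-1 - t)) \<le> 1 + (1 - real (Suc K) powr (-t)) / t" for K
  proof (induction K)
    case (Suc K)
    let ?x = "real (Suc K)"
    have "\<exists>z>?x. z < ?x + 1 \<and> (?x + 1) powr (-t) - ?x powr (-t) = (?x + 1 - ?x) * (- t * z powr (-t - 1))"
      by (intro MVT2) (auto intro!: derivative_eq_intros)
    then obtain z where z: "z > ?x" "z < ?x + 1"
      "(?x + 1) powr (-t) - ?x powr (-t) = (?x + 1 - ?x) * (- t * z powr (-t - 1))" by blast
    have "-t - 1 = -1 - t" by simp
    then have z3: "(?x + 1) powr (-t) - ?x powr (-t) = - (t * z powr (-1 - t))"
      using z(3) by (simp only:) simp
    have "(?x + 1) powr (-1 - t) \<le> z powr (-1 - t)"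
      using z t by (intro powr_mono2') auto
    also have "\<dots> = (?x powr (-t) - (?x + 1) powr (-t)) / t"
      using z3 t by (simp add: field_simps)
    finally show ?case using Suc by (simp add: diff_divide_distrib add.commute)
  qed (use t in simp)
  moreover have "(1 - real (Suc K) powr (-t)) / t \<le> 1 / t" for K
    using t by (intro divide_right_mono) auto
  ultimately have "(\<Sum>n=1..Suc K. real n powr (-1 - t)) \<le> 1 + 1 / t" for K
    by (meson add_left_mono order_trans)
  then show ?thesis using t by (cases K) auto
qed

text \<open>Rankin's trick: \<open>1/p \<le> exp \<epsilon> * p powr (-s)\<close> for \<open>p \<le> N\<close> and \<open>s = 1 + \<epsilon> / ln N\<close>, and the sum of
  \<open>p powr (-s)\<close> is controlled by the Euler product.\<close>

lemma prime_recip_sum_le: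
  fixes \<epsilon> :: real
  assumes N: "N \<ge> 2" and \<epsilon>: "\<epsilon> > 0"
  shows "prime_recip_sum N \<le> exp \<epsilon> * (ln (1 + ln (real N) / \<epsilon>) + 2)"
proof -
  define t where "t = \<epsilon> / ln (real N)"
  let ?P = "primes_upto N"
  let ?w = "\<lambda>p. real p powr (-1 - t)"
  have lnN: "ln (real N) > 0" using N by simp
  then have t: "t > 0" using \<epsilon> by (simp add: t_def)
  have P: "p > 1" "p \<le> N" "prime p" if "p \<in> ?P" for p
    using that prime_gt_1_nat by (auto simp: primes_upto_def)
  have w: "0 \<le> ?w p" "?w p \<le> 1 / real p" if "p \<in> ?P" for p
    using P[OF that] t powr_mono[of "-1 - t" "-1" "real p"] by (auto simp: powr_minus_divide)
  let ?D = "(\<lambda>S. \<Prod>S) ` Pow ?P"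
  have inj: "inj_on (\<lambda>S. \<Prod>S) (Pow ?P)"
    using P by (intro inj_on_prod_primes) (auto intro: finite_subset)
  \<comment> \<open>The Euler product expands into one term per squarefree integer built from these
    primes; the integers are distinct, so a partial zeta sum dominates.\<close>
  have "(\<Prod>p\<in>?P. ?w p + 1) = (\<Sum>S\<in>Pow ?P. \<Prod>p\<in>S. ?w p)"
    by (simp add: prod_add)
  also have "\<dots> = (\<Sum>S\<in>Pow ?P. ?w (\<Prod>S))"
    by (intro sum.cong refl) (simp add: prod_powr_distrib)
  also have "\<dots> = (\<Sum>n\<in>?D. ?w n)"
    using inj by (simp add: sum.reindex)
  also have "\<dots> \<le> (\<Sum>n=1..Max ?D. ?w n)"
  proof (intro sum_mono2)
    show "?D \<subseteq> {1..Max ?D}"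
    proof
      fix n assume n: "n \<in> ?D"
      then have "n > 0" using P by (auto intro!: prod_primes_pos)
      moreover have "n \<le> Max ?D" using n by (intro Max_ge) auto
      ultimately show "n \<in> {1..Max ?D}" by simp
    qed
  qed auto
  also have "\<dots> \<le> 1 + 1 / t" by (rule sum_powr_le[OF t])
  finally have prod_le: "(\<Prod>p\<in>?P. ?w p + 1) \<le> 1 + ln (real N) / \<epsilon>" by (simp add: t_def)
  \<comment> \<open>Prepares for \<open>ln (1 + x) \<ge> x - x\<^sup>2\<close>, applied to each
    weight; the squares add up to at most 2, the source of the additive 2.\<close>
  have "(\<Sum>p\<in>?P. ?w p) - 2 \<le> (\<Sum>p\<in>?P. ?w p) - (\<Sum>p\<in>?P. (?w p)\<^sup>2)"
  proof -
    have "(\<Sum>p\<in>?P. (?w p)\<^sup>2) \<le> (\<Sum>p\<in>?P. 1 / (real p)\<^sup>2)"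
      using w by (intro sum_mono) (metis power_mono power_one_over)
    also have "\<dots> \<le> (\<Sum>p=1..N. 1 / (real p)\<^sup>2)"
      using P order.strict_trans[OF zero_less_one] by (intro sum_mono2) (force simp: Suc_le_eq)+
    finally show ?thesis using sum_inverse_squares_le[of N] by linarith
  qed
  also have "\<dots> \<le> (\<Sum>p\<in>?P. ln (?w p + 1))"
    unfolding sum_subtractf[symmetric]
  proof (intro sum_mono)
    fix p assume p: "p \<in> ?P"
    have "?w p \<le> 1" using w(2)[OF p] P(1)[OF p] by (smt (verit) divide_le_eq_1 of_nat_1 of_nat_less_iff)
    then show "?w p - (?w p)\<^sup>2 \<le> ln (?w p + 1)"
      using ln_one_plus_pos_lower_bound[of "?w p"] w(1)[OF p] by (simp add: add.commute)
  qed
  also have "\<dots> = ln (\<Prod>p\<in>?P. ?w p + 1)"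
  proof (rule ln_prod[symmetric])
    show "?w p + 1 \<noteq> 0" for p using powr_ge_zero[of "real p" "-1 - t"] by linarith
  qed simp
  also have "\<dots> \<le> ln (1 + ln (real N) / \<epsilon>)"
    using prod_le w(1) by (intro ln_mono prod_pos) (auto intro!: add_nonneg_pos)
  finally have *: "(\<Sum>p\<in>?P. ?w p) \<le> ln (1 + ln (real N) / \<epsilon>) + 2" by simp
  have "prime_recip_sum N \<le> (\<Sum>p\<in>?P. exp \<epsilon> * ?w p)"
    unfolding prime_recip_sum_def
  proof (rule sum_mono)
    fix p assume p: "p \<in> ?P"
    have "real p powr t \<le> real N powr t" using P[OF p] t by (intro powr_mono2) auto
    also have "\<dots> = exp \<epsilon>" using N lnN by (simp add: powr_def t_def)
    finally have "real p powr t * ?w p \<le> exp \<epsilon> * ?w p" by (intro mult_right_mono) auto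
    moreover have "real p powr t * ?w p = 1 / real p"
      using P[OF p] by (simp add: powr_add[symmetric] powr_minus_divide)
    ultimately show "1 / real p \<le> exp \<epsilon> * ?w p" by simp
  qed
  also have "\<dots> \<le> exp \<epsilon> * (ln (1 + ln (real N) / \<epsilon>) + 2)"
    using * by (simp add: sum_distrib_left[symmetric])
  finally show ?thesis .
qed

section \<open>Products over blocks of primes\<close>

text \<open>When elements are added one at a time, the total passes \<open>\<tau>\<close> by at most
  the weight of the last one.\<close>

lemma exists_subset_sum_between:
  fixes w :: "'a \<Rightarrow> real"
  assumes "finite P" "\<And>p. p \<in> P \<Longrightarrow> 0 \<le> w p \<and> w p \<le> \<epsilon>" "\<epsilon> \<ge> 0" "\<tau> \<le> sum w P" "\<tau> \<ge> 0"
  shows "\<exists>Q\<subseteq>P. \<tau> \<le> sum w Q \<and> sum w Q \<le> \<tau> + \<epsilon>"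
  using assms
proof (induction P rule: finite_induct)
  case (insert p P)
  show ?case
  proof (cases "\<tau> \<le> sum w P")
    case True
    then obtain Q where "Q \<subseteq> P" "\<tau> \<le> sum w Q" "sum w Q \<le> \<tau> + \<epsilon>" using insert by auto
    then show ?thesis by blast
  next
    case False
    then have "sum w (insert p P) \<le> \<tau> + \<epsilon>" using insert.prems(1)[of p] insert.hyps by simp
    then show ?thesis using insert.prems by blast
  qed
qed auto

text \<open>Greedy: each class cut off uses mass at most \<open>\<tau> + \<epsilon>\<close>, so
  there is enough for \<open>K\<close> of them. Leftover points get arbitrary colours, which can
  only make classes heavier.\<close>

lemma exists_colouring_heavy_classes:
  fixes w :: "'a \<Rightarrow> real"
  assumes "finite P" "\<And>p. p \<in> P \<Longrightarrow> 0 \<le> w p \<and> w p \<le> \<epsilon>" "\<epsilon> \<ge> 0" "\<tau> \<ge> 0"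
    and "real K * (\<tau> + \<epsilon>) \<le> sum w P"
  shows "\<exists>h :: 'a \<Rightarrow> nat. \<forall>i<K. \<tau> \<le> (\<Sum>p\<in>{p\<in>P. h p = i}. w p)"
  using assms
proof (induction K arbitrary: P)
  case (Suc K)
  have "0 \<le> real K * (\<tau> + \<epsilon>)" using Suc.prems by simp
  moreover have step: "real (Suc K) * (\<tau> + \<epsilon>) = real K * (\<tau> + \<epsilon>) + (\<tau> + \<epsilon>)"
    by (simp add: distrib_right)
  ultimately have "\<tau> \<le> sum w P" using Suc.prems(3-5) by linarith
  then obtain Q where Q: "Q \<subseteq> P" "\<tau> \<le> sum w Q" "sum w Q \<le> \<tau> + \<epsilon>"
    using exists_subset_sum_between[of P w \<epsilon> \<tau>] Suc.prems by blast
  have "sum w (P - Q) = sum w P - sum w Q" using Q Suc.prems by (intro sum_diff) auto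
  then have "real K * (\<tau> + \<epsilon>) \<le> sum w (P - Q)" using Suc.prems(5) Q step by linarith
  then obtain h :: "'a \<Rightarrow> nat" where h: "\<And>i. i < K \<Longrightarrow> \<tau> \<le> (\<Sum>p\<in>{p\<in>P - Q. h p = i}. w p)"
    using Suc.IH[of "P - Q"] Suc.prems by auto
  define h' where "h' = (\<lambda>p. if p \<in> Q then K else h p)"
  have "\<tau> \<le> (\<Sum>p\<in>{p\<in>P. h' p = i}. w p)" if "i < Suc K" for i
  proof (cases "i = K")
    case True
    have "sum w Q \<le> (\<Sum>p\<in>{p\<in>P. h' p = i}. w p)"
      using Suc.prems Q True by (intro sum_mono2) (auto simp: h'_def)
    then show ?thesis using Q by linarith
  next
    case False
    then have "{p\<in>P. h' p = i} = {p\<in>P - Q. h p = i}" by (auto simp: h'_def)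
    then show ?thesis using h[of i] that False by simp
  qed
  then show ?case by blast
qed auto

text \<open>Induction on the number of blocks: \<open>G\<close> is pulled back to the next
  \<open>n\<close> colours and joined to the family on the earlier blocks. The uniform size
  \<open>r * m\<close> is carried along because the join lemma needs it.\<close>

lemma exists_block_family:
  fixes h :: "'a \<Rightarrow> nat" and w :: "'a \<Rightarrow> real"
  assumes k: "k \<ge> 3" and finP: "finite P" and w: "\<And>p. p \<in> P \<Longrightarrow> 0 \<le> w p" and \<tau>: "\<tau> \<ge> 0"
    and G: "G \<subseteq> {S. S \<subseteq> {1..n::nat} \<and> card S = r}" and free: "cosunflower_free k G"
    and heavy: "\<And>i. i < n * m \<Longrightarrow> \<tau> \<le> (\<Sum>p\<in>{p\<in>P. h p = i}. w p)"
  shows "\<exists>F. F \<subseteq> Pow {p\<in>P. h p < n * m} \<and> (\<forall>S\<in>F. card S = r * m) \<and> cosunflower_free k F \<and>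
    (real (card G) * \<tau> ^ r) ^ m \<le> (\<Sum>S\<in>F. \<Prod>p\<in>S. w p)"
  using heavy
proof (induction m)
  case 0
  \<comment> \<open>With no blocks the family consists of the empty set alone, of weight 1 as an
    empty product.\<close>
  have "cosunflower_free k {{} :: 'a set}"
    unfolding cosunflower_free_def cosunflower_def
    using k card_mono[of "{{} :: 'a set}"] by fastforce
  then show ?case by (intro exI[of _ "{{}}"]) auto
next
  case (Suc m)
  define X where "X = {p\<in>P. h p < n * m}"
  define Y where "Y = {p\<in>P. n * m \<le> h p \<and> h p < n * Suc m}"
  \<comment> \<open>Shifts the colours of the new block to \<open>1..n\<close>, the ground set of
    \<open>G\<close>; on \<open>Y\<close> the subtraction never truncates, since
    \<open>n * m \<le> h p\<close>.\<close>
  define col where "col = (\<lambda>p. h p + 1 - n * m)"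
  define H where "H = pullback col Y G"
  have "\<exists>F. F \<subseteq> Pow X \<and> (\<forall>S\<in>F. card S = r * m) \<and> cosunflower_free k F \<and>
      (real (card G) * \<tau> ^ r) ^ m \<le> (\<Sum>S\<in>F. \<Prod>p\<in>S. w p)"
    unfolding X_def by (rule Suc.IH, rule Suc.prems) simp
  then obtain F where F: "F \<subseteq> Pow X" "\<forall>S\<in>F. card S = r * m" "cosunflower_free k F"
    "(real (card G) * \<tau> ^ r) ^ m \<le> (\<Sum>S\<in>F. \<Prod>p\<in>S. w p)"
    by (elim exE conjE) (rule that)
  have fin: "finite X" "finite Y" "X \<inter> Y = {}" using finP by (auto simp: X_def Y_def)
  have finG: "finite G" using G by (rule finite_subset) simp
  have memG: "finite S" "card S = r" "S \<subseteq> {1..n}" if "S \<in> G" for S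
    using that G by (auto intro: finite_subset)
  have H: "H \<subseteq> Pow Y" "cosunflower_free k H" "\<And>S. S \<in> H \<Longrightarrow> card S = r"
  proof -
    show "H \<subseteq> Pow Y" by (auto simp: H_def pullback_def)
    show "cosunflower_free k H"
      unfolding H_def by (rule cosunflower_free_pullback[OF k fin(2) memG(2) free])
    show "card S = r" if "S \<in> H" for S
      using that card_pullback_mem[OF memG(2), where h = col and X = Y and S = S] unfolding H_def by simp
  qed
  have heavy_class: "\<tau> \<le> (\<Sum>p\<in>{p\<in>Y. col p = i}. w p)" if i: "i \<in> {1..n}" for i
  proof -
    have "{p\<in>Y. col p = i} = {p\<in>P. h p = n * m + (i - 1)}" using i by (auto simp: Y_def col_def)
    then show ?thesis using Suc.prems[of "n * m + (i - 1)"] i by auto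
  qed
  have "real (card G) * \<tau> ^ r = (\<Sum>S\<in>G. \<Prod>i\<in>S. \<tau>)" using memG by simp
  also have "\<dots> \<le> (\<Sum>S\<in>G. \<Prod>i\<in>S. \<Sum>p\<in>{p\<in>Y. col p = i}. w p)"
    using memG(3) heavy_class \<tau> by (intro sum_mono prod_mono) blast
  also have "\<dots> = (\<Sum>S\<in>H. \<Prod>p\<in>S. w p)"
    unfolding H_def by (rule sum_pullback_prod[symmetric]) (use fin finG memG in auto)
  finally have wH: "real (card G) * \<tau> ^ r \<le> (\<Sum>S\<in>H. \<Prod>p\<in>S. w p)" .
  let ?J = "(\<lambda>(S, T). S \<union> T) ` (F \<times> H)"
  have XY: "X \<subseteq> {p\<in>P. h p < n * Suc m}" "Y \<subseteq> {p\<in>P. h p < n * Suc m}"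
    by (auto simp: X_def Y_def)
  have "(real (card G) * \<tau> ^ r) ^ Suc m \<le> (\<Sum>S\<in>H. \<Prod>p\<in>S. w p) * (\<Sum>S\<in>F. \<Prod>p\<in>S. w p)"
    unfolding power_Suc
  proof (rule mult_mono[OF wH F(4)])
    have "0 \<le> real (card G) * \<tau> ^ r" using \<tau> by simp
    then show "0 \<le> (\<Sum>S\<in>H. \<Prod>p\<in>S. w p)" using wH by linarith
  qed (use \<tau> in simp)
  also have "\<dots> = (\<Sum>S\<in>?J. \<Prod>p\<in>S. w p)"
    by (subst sum_prod_Un_disjoint[OF fin F(1) H(1)]) simp
  finally have "(real (card G) * \<tau> ^ r) ^ Suc m \<le> (\<Sum>S\<in>?J. \<Prod>p\<in>S. w p)" .
  moreover have "cosunflower_free k ?J"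
    by (rule cosunflower_free_join[OF k fin F(1) H(1) _ H(3) F(3) H(2)]) (use F in auto)
  moreover have "card (S \<union> T) = r * Suc m" if ST: "S \<in> F" "T \<in> H" for S T
  proof -
    have "S \<subseteq> X" "T \<subseteq> Y" using ST F H by auto
    then have "card (S \<union> T) = card S + card T"
      using fin by (intro card_Un_disjoint) (auto intro: finite_subset)
    then show ?thesis using F(2) H(3) ST by simp
  qed
  moreover have "?J \<subseteq> Pow {p\<in>P. h p < n * Suc m}"
    using F(1) H(1) XY by blast
  ultimately show ?case by (intro exI[of _ ?J] conjI) auto
qed

section \<open>Basic bounds for \<open>f_lcm\<close> and the lower bound from block families\<close>

lemma f_lcm_finite: "finite {(\<Sum>a\<in>A. 1 / real a) | A. A \<subseteq> {1..N} \<and> lcm_free k A}"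
proof -
  have "finite ((\<lambda>A. \<Sum>a\<in>A. 1 / real a) ` Pow {1..N})" by simp
  then show ?thesis by (rule finite_subset[rotated]) auto
qed

lemma sum_le_f_lcm:
  assumes "A \<subseteq> {1..N}" "lcm_free k A"
  shows "(\<Sum>a\<in>A. 1 / real a) \<le> f_lcm k N"
  unfolding f_lcm_def by (rule Max_ge[OF f_lcm_finite]) (use assms in blast)

lemma f_lcm_le:
  assumes "k > 0" and bound: "\<And>A. A \<subseteq> {1..N} \<Longrightarrow> lcm_free k A \<Longrightarrow> (\<Sum>a\<in>A. 1 / real a) \<le> C"
  shows "f_lcm k N \<le> C"
proof -
  have "lcm_free k {}" using assms(1) by (auto simp: lcm_free_def)
  then have "f_lcm k N \<in> {(\<Sum>a\<in>A. 1 / real a) | A. A \<subseteq> {1..N} \<and> lcm_free k A}"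
    unfolding f_lcm_def by (intro Max_in[OF f_lcm_finite]) blast
  then show ?thesis using bound by auto
qed

lemma f_lcm_ge_one:
  assumes "k \<ge> 3" "N \<ge> 1"
  shows "f_lcm k N \<ge> 1"
proof -
  have "card B \<noteq> k" if "B \<subseteq> {1::nat}" for B using card_mono[OF _ that] assms by auto
  then have "lcm_free k {1}" by (auto simp: lcm_free_def)
  then show ?thesis using sum_le_f_lcm[of "{1}" N k] assms by simp
qed

text \<open>The mass condition provides \<open>n * m\<close> heavy classes of primes for
  \<open>m\<close> blocks. Each member of the block family consists of \<open>r * m\<close> primes
  up to \<open>y\<close>, so its product stays within \<open>N\<close>.\<close>

lemma f_lcm_ge_block_power:
  fixes \<tau> \<epsilon> :: real
  assumes k: "k \<ge> 3" and \<tau>: "\<tau> \<ge> 0" and \<epsilon>: "\<epsilon> > 0" and y: "y \<ge> 1"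
    and mass: "real (n * m) * (\<tau> + \<epsilon>) \<le> prime_recip_sum y - prime_recip_sum (nat \<lfloor>1 / \<epsilon>\<rfloor>)"
    and size: "y ^ (r * m) \<le> N"
  shows "(real (M_cosun k n r) * \<tau> ^ r) ^ m \<le> f_lcm k N"
proof -
  let ?w = "\<lambda>p. 1 / real p"
  \<comment> \<open>Dropping the primes up to \<open>1 / \<epsilon>\<close> makes every reciprocal
    at most \<open>\<epsilon>\<close>, as the greedy colouring requires.\<close>
  define P where "P = primes_upto y - primes_upto (nat \<lfloor>1 / \<epsilon>\<rfloor>)"
  obtain G where G: "G \<subseteq> {S. S \<subseteq> {1..n} \<and> card S = r}" "cosunflower_free k G"
    "card G = M_cosun k n r" using M_cosun_attained[of k n r] k by (metis not_numeral_le_zero gr0I)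
  have P: "finite P" "\<And>p. p \<in> P \<Longrightarrow> prime p" "\<And>p. p \<in> P \<Longrightarrow> p \<le> y"
    by (auto simp: P_def primes_upto_def)
  have small: "0 \<le> ?w p \<and> ?w p \<le> \<epsilon>" if p: "p \<in> P" for p
  proof -
    have "p > nat \<lfloor>1 / \<epsilon>\<rfloor>" using p P(2)[OF p] by (auto simp: P_def primes_upto_def)
    then have "real p \<ge> 1 / \<epsilon>" by linarith
    then have "1 \<le> real p * \<epsilon>" using \<epsilon> by (simp add: pos_divide_le_eq)
    then show ?thesis using prime_gt_0_nat[OF P(2)[OF p]] by (simp add: pos_divide_le_eq mult.commute)
  qed
  have "prime_recip_sum y - prime_recip_sum (nat \<lfloor>1 / \<epsilon>\<rfloor>) \<le> sum ?w P"
  proof -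
    have "prime_recip_sum y \<le> sum ?w (P \<union> primes_upto (nat \<lfloor>1 / \<epsilon>\<rfloor>))"
      unfolding prime_recip_sum_def by (rule sum_mono2) (auto simp: P_def)
    also have "\<dots> = sum ?w P + prime_recip_sum (nat \<lfloor>1 / \<epsilon>\<rfloor>)"
      unfolding prime_recip_sum_def by (rule sum.union_disjoint) (auto simp: P_def)
    finally show ?thesis by simp
  qed
  then have "\<exists>h :: nat \<Rightarrow> nat. \<forall>i<n * m. \<tau> \<le> (\<Sum>p\<in>{p\<in>P. h p = i}. ?w p)"
    using mass small \<tau> \<epsilon> P(1) by (intro exists_colouring_heavy_classes[where \<epsilon> = \<epsilon>]) auto
  then obtain h :: "nat \<Rightarrow> nat" where "\<And>i. i < n * m \<Longrightarrow> \<tau> \<le> (\<Sum>p\<in>{p\<in>P. h p = i}. ?w p)"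
    by blast
  then obtain F where F: "F \<subseteq> Pow {p\<in>P. h p < n * m}" "\<forall>S\<in>F. card S = r * m"
    "cosunflower_free k F"
    "(real (card G) * \<tau> ^ r) ^ m \<le> (\<Sum>S\<in>F. \<Prod>p\<in>S. ?w p)"
    using exists_block_family[OF k P(1) _ \<tau> G(1,2), of ?w m h] by auto
  have memF: "finite S" "\<And>p. p \<in> S \<Longrightarrow> prime p" "\<And>p. p \<in> S \<Longrightarrow> p \<le> y" "card S = r * m"
    if "S \<in> F" for S
  proof -
    have "S \<subseteq> P" using F(1) that by auto
    then show "finite S" "\<And>p. p \<in> S \<Longrightarrow> prime p" "\<And>p. p \<in> S \<Longrightarrow> p \<le> y" "card S = r * m"
      using P F(2) that finite_subset by auto
  qed
  let ?A = "(\<lambda>S. \<Prod>S) ` F"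
  have "?A \<subseteq> {1..N}"
  proof clarify
    fix S assume S: "S \<in> F"
    have "\<Prod>S > 0" using memF(2)[OF S] by (rule prod_primes_pos)
    moreover have "\<Prod>S \<le> (\<Prod>p\<in>S. y)" using memF(3)[OF S] by (intro prod_mono) auto
    ultimately show "\<Prod>S \<in> {1..N}" using size memF(4)[OF S] by simp
  qed
  moreover have "lcm_free k ?A" by (rule lcm_free_prod_image[OF _ F(3)]) (use memF in auto)
  ultimately have "(\<Sum>a\<in>?A. 1 / real a) \<le> f_lcm k N" by (rule sum_le_f_lcm)
  moreover have "(\<Sum>a\<in>?A. 1 / real a) = (\<Sum>S\<in>F. \<Prod>p\<in>S. ?w p)"
    unfolding prod_inverse_eq
    by (subst sum.reindex[OF inj_on_prod_primes]) (use memF in auto)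
  ultimately show ?thesis using F(4) G(3) by simp
qed

section \<open>The weighted upper bound\<close>

lemma nat_floor_ratio_tendsto:
  fixes x :: real
  assumes "x \<ge> 0"
  shows "(\<lambda>n. real (nat \<lfloor>real n * x\<rfloor>) / real n) \<longlonglongrightarrow> x"
proof (rule tendsto_sandwich)
  show "\<forall>\<^sub>F n in sequentially. x - 1 / real n \<le> real (nat \<lfloor>real n * x\<rfloor>) / real n"
  proof (rule eventually_mono[OF eventually_gt_at_top[of 0]])
    fix n :: nat assume "n > 0"
    then have "x - 1 / real n = (real n * x - 1) / real n" by (simp add: field_simps)
    also have "\<dots> \<le> real (nat \<lfloor>real n * x\<rfloor>) / real n"
      by (intro divide_right_mono) linarith+
    finally show "x - 1 / real n \<le> real (nat \<lfloor>real n * x\<rfloor>) / real n" .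
  qed
  show "\<forall>\<^sub>F n in sequentially. real (nat \<lfloor>real n * x\<rfloor>) / real n \<le> x"
  proof (rule eventually_mono[OF eventually_gt_at_top[of 0]])
    fix n :: nat assume "n > 0"
    moreover have "real (nat \<lfloor>real n * x\<rfloor>) \<le> real n * x" using assms by simp
    ultimately show "real (nat \<lfloor>real n * x\<rfloor>) / real n \<le> x"
      by (simp add: field_simps)
  qed
  show "(\<lambda>n. x - 1 / real n) \<longlonglongrightarrow> x" by real_asymp
qed simp

text \<open>Blowing up each \<open>p\<close> into about \<open>n * w p / sum w P\<close> copies turns the weighted sum over \<open>B\<close>
  into the size of a cosunflower-free family on at most \<open>n\<close> points.\<close>

lemma weighted_sum_level_le:
  fixes w :: "'a \<Rightarrow> real"
  assumes k: "k \<ge> 3" and finP: "finite P" and w: "\<And>p. p \<in> P \<Longrightarrow> 0 \<le> w p" and W: "sum w P > 0"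
    and B: "B \<subseteq> Pow P" "\<And>S. S \<in> B \<Longrightarrow> card S = t" and free: "cosunflower_free k B"
    and t: "t \<ge> 1" and M: "\<And>n. n \<ge> t \<Longrightarrow> real (M_cosun k n t) \<le> (c * real n / real t) ^ t"
  shows "(\<Sum>S\<in>B. \<Prod>p\<in>S. w p) \<le> (sum w P * c / real t) ^ t"
proof -
  define x where "x = (\<lambda>p. w p / sum w P)"
  \<comment> \<open>The number of copies of \<open>p\<close>; rounding down keeps the total number
    of copies at most \<open>n\<close>.\<close>
  define m where "m = (\<lambda>n p. nat \<lfloor>real n * x p\<rfloor>)"
  have x: "x p \<ge> 0" if "p \<in> P" for p using w[OF that] W by (simp add: x_def)
  have sumx: "sum x P = 1" using W by (simp add: x_def flip: sum_divide_distrib)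
  have finB: "finite B" using B(1) finP finite_subset by blast
  have memB: "finite S" "S \<subseteq> P" if "S \<in> B" for S using that B(1) finP by (auto intro: rev_finite_subset)
  have "(\<Sum>S\<in>B. \<Prod>p\<in>S. real (m n p) / real n) \<le> (c / real t) ^ t" if n: "n \<ge> t" for n
  proof -
    define X where "X = Sigma P (\<lambda>p. {..<m n p})"
    let ?H = "pullback fst X B"
    have "finite X" using finP by (simp add: X_def)
    have "real (card X) = (\<Sum>p\<in>P. real (m n p))" using finP by (simp add: X_def)
    also have "\<dots> \<le> (\<Sum>p\<in>P. real n * x p)"
      using x by (intro sum_mono) (simp add: m_def)
    also have "\<dots> = real n" using sumx by (simp flip: sum_distrib_left)
    finally have "card X \<le> n" by simp
    then have "card ?H \<le> M_cosun k n t"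
    proof (rule card_le_M_cosun[OF k \<open>finite X\<close>])
      show "?H \<subseteq> Pow X" by (auto simp: pullback_def)
      show "card S = t" if "S \<in> ?H" for S
        using card_pullback_mem[OF B(2) that] .
      show "cosunflower_free k ?H"
        by (rule cosunflower_free_pullback[OF k \<open>finite X\<close> B(2) free])
    qed
    moreover have "card ?H = (\<Sum>S\<in>B. \<Prod>p\<in>S. m n p)"
    proof -
      have "card ?H = (\<Sum>S\<in>?H. \<Prod>p\<in>S. 1)" by simp
      also have "\<dots> = (\<Sum>S\<in>B. \<Prod>p\<in>S. \<Sum>q\<in>{q\<in>X. fst q = p}. 1)"
        by (rule sum_pullback_prod[OF \<open>finite X\<close> finB memB(1)])
      also have "\<dots> = (\<Sum>S\<in>B. \<Prod>p\<in>S. m n p)"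
      proof (intro sum.cong prod.cong refl)
        fix S p assume "S \<in> B" "p \<in> S"
        then have "{q\<in>X. fst q = p} = Pair p ` {..<m n p}"
          using memB(2) by (auto simp: X_def)
        then show "(\<Sum>q\<in>{q\<in>X. fst q = p}. 1) = m n p"
          by (simp add: card_image inj_on_def)
      qed
      finally show ?thesis .
    qed
    ultimately have "(\<Sum>S\<in>B. \<Prod>p\<in>S. m n p) \<le> M_cosun k n t" by simp
    then have "real (\<Sum>S\<in>B. \<Prod>p\<in>S. m n p) \<le> (c * real n / real t) ^ t"
      using M[OF n] by linarith
    then have "(\<Sum>S\<in>B. \<Prod>p\<in>S. real (m n p)) \<le> (c / real t) ^ t * real n ^ t"
      by (simp add: power_mult_distrib power_divide mult.commute)
    moreover have "(\<Sum>S\<in>B. \<Prod>p\<in>S. real (m n p) / real n) = (\<Sum>S\<in>B. \<Prod>p\<in>S. real (m n p)) / real n ^ t"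
      using B(2) by (simp add: prod_dividef sum_divide_distrib)
    ultimately show ?thesis using n t by (simp add: pos_divide_le_eq)
  qed
  \<comment> \<open>The bound just obtained is free of \<open>n\<close>, so it survives the limit in
    which the proportion of copies of \<open>p\<close> tends to \<open>x p\<close>.\<close>
  moreover have "(\<lambda>n. \<Sum>S\<in>B. \<Prod>p\<in>S. real (m n p) / real n) \<longlonglongrightarrow> (\<Sum>S\<in>B. \<Prod>p\<in>S. x p)"
    unfolding m_def using memB(2) x
    by (intro tendsto_sum tendsto_prod nat_floor_ratio_tendsto) blast
  ultimately have "(\<Sum>S\<in>B. \<Prod>p\<in>S. x p) \<le> (c / real t) ^ t"
    by (intro LIMSEQ_le_const2) blast+
  moreover have "(\<Sum>S\<in>B. \<Prod>p\<in>S. x p) = (\<Sum>S\<in>B. \<Prod>p\<in>S. w p) / sum w P ^ t"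
    using B(2) by (simp add: x_def prod_dividef sum_divide_distrib)
  ultimately have "(\<Sum>S\<in>B. \<Prod>p\<in>S. w p) \<le> (c / real t) ^ t * sum w P ^ t"
    using W by (simp add: pos_divide_le_eq)
  then show ?thesis by (simp add: power_mult_distrib power_divide mult.commute)
qed

text \<open>The left side as a function of real \<open>t\<close> peaks at \<open>t = a\<close>. The
  proof applies \<open>1 + x \<le> exp x\<close> at \<open>x = a / t - 1\<close>.\<close>

lemma power_exp_bound:
  fixes a :: real
  assumes "a \<ge> 0" "t \<ge> 1"
  shows "(a * exp 1 / real t) ^ t \<le> exp a"
proof -
  have "a / real t \<le> exp (a / real t - 1)" using exp_ge_add_one_self[of "a / real t - 1"] by simp
  then have "a * exp 1 / real t \<le> exp (a / real t)"
    by (simp add: exp_diff pos_le_divide_eq)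
  then have "(a * exp 1 / real t) ^ t \<le> exp (a / real t) ^ t"
    using assms by (intro power_mono) auto
  also have "\<dots> = exp a" using assms by (simp flip: exp_of_nat_mult)
  finally show ?thesis .
qed

text \<open>Weak Stirling bound: \<open>r ^ r / fact r\<close> is a single term of the exponential
  series at \<open>r\<close>.\<close>

lemma fact_ge_power: "(real r / exp 1) ^ r \<le> fact r"
proof (cases "r = 0")
  case False
  have "real r ^ r / fact r \<le> exp (real r)"
    using sum_le_suminf[OF summable_exp_generic[of "real r"], of "{r}"]
    by (simp add: exp_def inverse_eq_divide)
  then show ?thesis by (simp add: power_divide pos_divide_le_eq mult.commute flip: exp_of_nat_mult)
qed simp

definition cosun_ratio :: "nat \<Rightarrow> nat \<Rightarrow> nat \<Rightarrow> real" where
  "cosun_ratio k n r = real r / (exp 1 * real n) * real (M_cosun k n r) powr (1 / real r)"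

lemma cosun_ratio_pos:
  assumes "k \<ge> 3" "1 \<le> r" "r \<le> n"
  shows "cosun_ratio k n r > 0"
  using M_cosun_pos[OF assms(1,3)] assms by (simp add: cosun_ratio_def)

lemma M_cosun_eq_ratio_power:
  assumes "k \<ge> 3" "1 \<le> r" "r \<le> n"
  shows "real (M_cosun k n r) = (cosun_ratio k n r * exp 1 * real n / real r) ^ r"
proof -
  have "cosun_ratio k n r * exp 1 * real n / real r = real (M_cosun k n r) powr (1 / real r)"
    using assms by (simp add: cosun_ratio_def)
  also have "\<dots> ^ r = real (M_cosun k n r)"
    using M_cosun_pos[OF assms(1,3)] assms by (simp add: powr_power)
  finally show ?thesis ..
qed

text \<open>The binomial coefficient is at most \<open>n ^ r / fact r\<close>, hence at most
  \<open>(exp 1 * n / r) ^ r\<close>. This makes the supremum finite and also controls the high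
  levels below.\<close>

lemma cosun_ratio_le_one:
  assumes "k \<ge> 3" "1 \<le> r" "r \<le> n"
  shows "cosun_ratio k n r \<le> 1"
proof -
  have "real (M_cosun k n r) * fact r \<le> real (n choose r) * fact r"
    using M_cosun_le_binomial[of k n r] assms by (intro mult_right_mono) auto
  also have "\<dots> \<le> real n ^ r"
    using binomial_fact_pow[of n r] by (metis of_nat_fact of_nat_le_iff of_nat_mult of_nat_power)
  finally have "real (M_cosun k n r) * fact r \<le> real n ^ r" .
  moreover have "real (M_cosun k n r) * (real r / exp 1) ^ r \<le> real (M_cosun k n r) * fact r"
    by (intro mult_left_mono fact_ge_power) auto
  ultimately have "real (M_cosun k n r) * (real r / exp 1) ^ r \<le> real n ^ r" by linarith
  then have "(cosun_ratio k n r * real n) ^ r \<le> real n ^ r"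
    unfolding M_cosun_eq_ratio_power[OF assms] using assms
    by (simp flip: power_mult_distrib)
  then have "cosun_ratio k n r * real n \<le> 1 * real n"
    using assms by (simp add: power_mono_iff cosun_ratio_def)
  then show ?thesis using assms by (simp add: mult_le_cancel_right)
qed

text \<open>Sort \<open>B\<close> by cardinality. Up to about \<open>2 * exp 1 * sum w P\<close> the
  levels contribute at most \<open>exp (\<gamma> * sum w P)\<close> each, and the later ones decay
  geometrically, so only a factor linear in the mass is lost.\<close>

lemma weighted_sum_le:
  fixes w :: "'a \<Rightarrow> real"
  assumes k: "k \<ge> 3" and finP: "finite P" and w: "\<And>p. p \<in> P \<Longrightarrow> 0 \<le> w p" and W: "sum w P > 0"
    and B: "B \<subseteq> Pow P" and free: "cosunflower_free k B"
    and \<gamma>: "\<gamma> \<ge> 0" "\<And>n r. 1 \<le> r \<Longrightarrow> r \<le> n \<Longrightarrow> cosun_ratio k n r \<le> \<gamma>"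
  shows "(\<Sum>S\<in>B. \<Prod>p\<in>S. w p) \<le> (2 * exp 1 * sum w P + 3) * exp (\<gamma> * sum w P)"
proof -
  let ?W = "sum w P"
  define E where "E = exp (\<gamma> * ?W)"
  have E: "E \<ge> 1" using \<gamma>(1) W by (simp add: E_def)
  have finB: "finite B" using B finP finite_subset by blast
  define T where "T = nat \<lfloor>2 * exp 1 * ?W\<rfloor>"
  have level: "(\<Sum>S\<in>{S\<in>B. card S = t}. \<Prod>p\<in>S. w p) \<le> (if t \<le> T then E else 0) + (1/2) ^ t" for t
  proof (cases "t = 0")
    case True
    have "{S\<in>B. card S = t} \<subseteq> {{}}" using True B finite_subset[OF _ finP] by (auto simp: card_eq_0_iff)
    then have "(\<Sum>S\<in>{S\<in>B. card S = t}. \<Prod>p\<in>S. w p) \<le> (\<Sum>S\<in>{{}}. \<Prod>p\<in>S. w p)"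
      by (intro sum_mono2) auto
    then show ?thesis using True E by simp
  next
    case False
    then have t: "t \<ge> 1" by simp
    \<comment> \<open>Kept general in \<open>c\<close>: low levels use \<open>\<gamma>\<close>, high
      levels the trivial value 1, for which the base is at most 1/2 beyond \<open>T\<close>.\<close>
    have bound: "(\<Sum>S\<in>{S\<in>B. card S = t}. \<Prod>p\<in>S. w p) \<le> (?W * (c * exp 1) / real t) ^ t"
      if c: "\<And>n r. 1 \<le> r \<Longrightarrow> r \<le> n \<Longrightarrow> cosun_ratio k n r \<le> c" for c
    proof (rule weighted_sum_level_le[OF k finP w W _ _ _ t])
      show "cosunflower_free k {S\<in>B. card S = t}" by (rule cosunflower_free_subset[OF free]) auto
      show "real (M_cosun k n t) \<le> (c * exp 1 * real n / real t) ^ t" if n: "n \<ge> t" for n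
        unfolding M_cosun_eq_ratio_power[OF k t n]
        using c[OF t n] cosun_ratio_pos[OF k t n]
        by (intro power_mono divide_right_mono mult_right_mono) auto
    qed (use B in auto)
    show ?thesis
    proof (cases "t \<le> T")
      case True
      have "(\<Sum>S\<in>{S\<in>B. card S = t}. \<Prod>p\<in>S. w p) \<le> (\<gamma> * ?W * exp 1 / real t) ^ t"
        using bound[OF \<gamma>(2)] by (simp add: mult_ac)
      also have "\<dots> \<le> E" unfolding E_def using \<gamma>(1) W t by (intro power_exp_bound) auto
      finally show ?thesis using True by (simp add: add_increasing2)
    next
      case False
      then have "2 * exp 1 * ?W \<le> real t" unfolding T_def by linarith
      then have "?W * (1 * exp 1) / real t \<le> 1 / 2" using t by (simp add: field_simps)
      then have "(?W * (1 * exp 1) / real t) ^ t \<le> (1 / 2) ^ t" using W by (intro power_mono) auto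
      then show ?thesis using bound[of 1] cosun_ratio_le_one[OF k] False by simp
    qed
  qed
  have "(\<Sum>S\<in>B. \<Prod>p\<in>S. w p) = (\<Sum>t\<in>{..card P}. \<Sum>S\<in>{S\<in>B. card S = t}. \<Prod>p\<in>S. w p)"
    using finB B finP by (intro sum.group[symmetric]) (auto intro: card_mono)
  also have "\<dots> \<le> (\<Sum>t\<in>{..card P}. (if t \<le> T then E else 0) + (1/2) ^ t)"
    by (intro sum_mono level)
  also have "\<dots> = (\<Sum>t\<in>{..card P} \<inter> {..T}. E) + (\<Sum>t\<in>{..card P}. (1/2) ^ t)"
    using sum.inter_restrict[of "{..card P}" "\<lambda>_. E" "{..T}"]
    by (simp only: sum.distrib atMost_iff finite_atMost)
  also have "\<dots> \<le> (\<Sum>t\<in>{..T}. E) + 2"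
  proof (intro add_mono)
    show "(\<Sum>t\<in>{..card P} \<inter> {..T}. E) \<le> (\<Sum>t\<in>{..T}. E)"
      using E by (intro sum_mono2) auto
    have "(\<Sum>t\<in>{..card P}. (1/2::real) ^ t) \<le> suminf (\<lambda>t. (1/2) ^ t)"
      by (intro sum_le_suminf summable_geometric) auto
    then show "(\<Sum>t\<in>{..card P}. (1/2::real) ^ t) \<le> 2" by (simp add: suminf_geometric)
  qed
  also have "\<dots> \<le> (2 * exp 1 * ?W + 1) * E + 2 * E"
  proof -
    have "real T \<le> 2 * exp 1 * ?W" unfolding T_def using W by simp
    then have "(real T + 1) * E \<le> (2 * exp 1 * ?W + 1) * E" using E by (intro mult_right_mono) auto
    moreover have "(\<Sum>t\<in>{..T}. E) = (real T + 1) * E" by simp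
    ultimately show ?thesis using E by linarith
  qed
  finally show ?thesis by (simp add: E_def algebra_simps)
qed

text \<open>For each \<open>d\<close>, the squarefree \<open>b\<close> with
  \<open>b * d\<^sup>2 \<in> A\<close> have cosunflower-free prime sets, so the weighted bound
  applies; the outer factor 2 comes from summing over \<open>d\<close>.\<close>

lemma f_lcm_upper:
  assumes k: "k \<ge> 3" and N: "N \<ge> 2"
    and \<gamma>: "\<gamma> \<ge> 0" "\<And>n r. 1 \<le> r \<Longrightarrow> r \<le> n \<Longrightarrow> cosun_ratio k n r \<le> \<gamma>"
  defines "W \<equiv> prime_recip_sum N"
  shows "f_lcm k N \<le> 2 * ((2 * exp 1 * W + 3) * exp (\<gamma> * W))"
proof (rule f_lcm_le)
  fix A assume A: "A \<subseteq> {1..N}" "lcm_free k A"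
  have "(\<Sum>p\<in>{2}. 1 / real p) \<le> W" unfolding W_def prime_recip_sum_def
    using N by (intro sum_mono2) (auto simp: primes_upto_def)
  then have W: "W > 0" by simp
  show "(\<Sum>a\<in>A. 1 / real a) \<le> 2 * ((2 * exp 1 * W + 3) * exp (\<gamma> * W))"
  proof (rule sum_inverse_le_squarefree[OF A(1)])
    fix d :: nat assume d: "d > 0"
    let ?B = "{b\<in>{1..N}. squarefree b \<and> b * d\<^sup>2 \<in> A}"
    have "(\<Sum>b\<in>?B. 1 / real b) = (\<Sum>S\<in>prime_factors ` ?B. \<Prod>p\<in>S. 1 / real p)"
      by (rule sum_inverse_squarefree_eq) blast
    also have "\<dots> \<le> (2 * exp 1 * W + 3) * exp (\<gamma> * W)"
      unfolding W_def prime_recip_sum_def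
    proof (rule weighted_sum_le[OF k finite_primes_upto _ _ _ _ \<gamma>])
      show "prime_factors ` ?B \<subseteq> Pow (primes_upto N)"
        using prime_factors_subset_primes_upto[of _ N] by blast
      show "cosunflower_free k (prime_factors ` ?B)"
        by (rule cosunflower_free_subset[OF cosunflower_free_prime_factors[OF A(2) d]]) blast
      show "(\<Sum>p\<in>primes_upto N. 1 / real p) > 0" using W by (simp add: W_def prime_recip_sum_def)
    qed auto
    finally show "(\<Sum>b\<in>?B. 1 / real b) \<le> (2 * exp 1 * W + 3) * exp (\<gamma> * W)" .
  qed (use W in simp)
qed (use k in simp)

section \<open>Asymptotics\<close>

lemma filterlim_ln_ln: "filterlim (\<lambda>N. ln (ln (real N))) at_top sequentially"
  by real_asymp

text \<open>With \<open>L = ln (ln N)\<close>, primes of mass about \<open>\<theta> * L\<close>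
  support about \<open>a * L\<close> blocks. Each block contributes a factor \<open>exp r\<close>,
  so \<open>ln (f_lcm k N)\<close> is at least about \<open>r * a * L\<close>.\<close>

lemma eventually_less_ln_f_lcm_ratio:
  assumes k: "k \<ge> 3" and r: "1 \<le> r" "r \<le> n" and c: "c < cosun_ratio k n r"
  shows "\<forall>\<^sub>F N in sequentially. c < ln (f_lcm k N) / ln (ln (real N))"
proof -
  define M where "M = real (M_cosun k n r)"
  define \<beta> where "\<beta> = cosun_ratio k n r"
  \<comment> \<open>Maximises \<open>ln (M * \<tau> ^ r) / (n * \<tau>)\<close>, the exponent gained
    per unit of mass; the maximum is \<open>\<beta>\<close>.\<close>
  define \<tau> where "\<tau> = exp 1 / M powr (1 / real r)"
  \<comment> \<open>\<open>r * a\<close> is the midpoint of \<open>max c 0\<close> and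
    \<open>\<beta>\<close>, where \<open>max\<close> keeps \<open>a\<close> positive. This gives
    \<open>a * n * \<tau> < 1\<close>; \<open>\<theta>\<close> is the midpoint of these two, and
    \<open>\<epsilon>\<close> puts \<open>a * n * (\<tau> + \<epsilon>)\<close> halfway between
    \<open>a * n * \<tau>\<close> and \<open>\<theta>\<close>.\<close>
  define a where "a = (max c 0 + \<beta>) / (2 * real r)"
  define \<theta> where "\<theta> = (1 + a * n * \<tau>) / 2"
  define \<epsilon> where "\<epsilon> = (\<theta> - a * n * \<tau>) / (2 * a * n)"
  define C where "C = prime_recip_sum (nat \<lfloor>1 / \<epsilon>\<rfloor>)"
  have pos: "M > 0" "\<beta> > 0" "real r > 0" "real n > 0"
    using M_cosun_pos[OF k r(2)] cosun_ratio_pos[OF k r] r by (auto simp: M_def \<beta>_def)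
  have \<tau>: "\<tau> > 0" using pos by (simp add: \<tau>_def)
  have a: "a > 0" "real r * a < \<beta>" "c < real r * a"
    using pos c by (auto simp: a_def \<beta>_def[symmetric] field_simps max_def)
  have "\<beta> = real r / (real n * \<tau>)"
    using pos by (simp add: \<beta>_def cosun_ratio_def \<tau>_def M_def)
  then have "\<beta> * (real n * \<tau>) = real r" using pos \<tau> by simp
  moreover have "real r * a * (real n * \<tau>) < \<beta> * (real n * \<tau>)"
    using a(2) pos \<tau> by (intro mult_strict_right_mono) auto
  ultimately have "real r * (a * n * \<tau>) < real r * 1" by (simp add: mult_ac)
  then have an: "a * n * \<tau> < 1" using pos(3) by (simp only: mult_less_cancel_left_pos)
  have \<theta>: "a * n * \<tau> < \<theta>" unfolding \<theta>_def by (rule less_half_sum[OF an, THEN order_less_le_trans]) (simp add: add.commute)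
  have \<theta>1: "\<theta> < 1"
    unfolding \<theta>_def by (rule order_le_less_trans[OF _ gt_half_sum[OF an]]) (simp add: add.commute)
  have \<epsilon>: "\<epsilon> > 0" using \<theta> a pos by (simp add: \<epsilon>_def)
  have an\<epsilon>: "a * n * (\<tau> + \<epsilon>) < \<theta>"
    using \<theta> a pos by (simp add: \<epsilon>_def field_simps)
  have M\<tau>: "M * \<tau> ^ r = exp (real r)"
  proof -
    have "(M powr (1 / real r)) ^ r = M" using pos by (simp add: powr_power)
    then show ?thesis using pos by (simp add: \<tau>_def power_divide flip: exp_of_nat_mult)
  qed
  \<comment> \<open>Three requirements for large \<open>L\<close>: enough mass after discarding the
    small primes, products at most \<open>N\<close>, and an exponent above \<open>c\<close> even
    after the number of blocks is rounded down.\<close>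
  have "\<forall>\<^sub>F L in at_top. a * n * (\<tau> + \<epsilon>) * L \<le> \<theta> * L - ln 2 - C"
    using an\<epsilon> by real_asymp
  moreover have "\<forall>\<^sub>F L in at_top. real r * (a * L) * exp (\<theta> * L) \<le> exp L"
  proof -
    have "\<eta> > 0 \<Longrightarrow> \<forall>\<^sub>F L in at_top. b * L \<le> exp (\<eta> * L)" for b \<eta> :: real
      by real_asymp
    from this[of "1 - \<theta>" "real r * a"] \<theta>1
    have "\<forall>\<^sub>F L in at_top. real r * a * L \<le> exp ((1 - \<theta>) * L)" by simp
    then show ?thesis
    proof eventually_elim
      case (elim L)
      then have "real r * a * L * exp (\<theta> * L) \<le> exp ((1 - \<theta>) * L) * exp (\<theta> * L)"
        by (intro mult_right_mono) auto
      also have "\<dots> = exp L" by (simp add: left_diff_distrib flip: exp_add)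
      finally show ?case by (simp add: mult.assoc)
    qed
  qed
  moreover have "\<forall>\<^sub>F L in at_top. c * L < real r * (a * L - 1)"
    using a pos by real_asymp
  moreover have "\<forall>\<^sub>F L::real in at_top. L > 0" by (rule eventually_gt_at_top)
  ultimately have "\<forall>\<^sub>F L in at_top. a * n * (\<tau> + \<epsilon>) * L \<le> \<theta> * L - ln 2 - C \<and>
      real r * (a * L) * exp (\<theta> * L) \<le> exp L \<and> c * L < real r * (a * L - 1) \<and> L > 0"
    by (intro eventually_conj)
  then have "\<forall>\<^sub>F N in sequentially. (\<lambda>L. a * n * (\<tau> + \<epsilon>) * L \<le> \<theta> * L - ln 2 - C \<and>
      real r * (a * L) * exp (\<theta> * L) \<le> exp L \<and> c * L < real r * (a * L - 1) \<and> L > 0)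
      (ln (ln (real N)))"
    by (rule eventually_compose_filterlim[OF _ filterlim_ln_ln])
  moreover have "\<forall>\<^sub>F N in sequentially. real N > exp 1"
    by real_asymp
  ultimately show ?thesis
  proof eventually_elim
    case (elim N)
    define L where "L = ln (ln (real N))"
    \<comment> \<open>Only primes up to \<open>exp ((ln N) powr \<theta>)\<close> with \<open>\<theta> < 1\<close> are used, so that products of
      \<open>r * m = O(ln ln N)\<close> of them stay below \<open>N\<close>.\<close>
    define y where "y = nat \<lfloor>exp (exp (\<theta> * L))\<rfloor>"
    define m where "m = nat \<lfloor>a * L\<rfloor>"
    have L: "a * n * (\<tau> + \<epsilon>) * L \<le> \<theta> * L - ln 2 - C"
      "real r * (a * L) * exp (\<theta> * L) \<le> exp L" "c * L < real r * (a * L - 1)" "L > 0"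
      using elim by (simp_all add: L_def)
    have "real N > 0" using elim(2) by (smt (verit) exp_gt_zero)
    then have "ln (real N) > 1" using elim(2) by (metis exp_less_cancel_iff exp_ln)
    then have "exp L = ln (real N)" unfolding L_def by (intro exp_ln) linarith
    then have N: "exp (exp L) = real N" using \<open>real N > 0\<close> by simp
    have floor: "real (nat \<lfloor>x\<rfloor>) \<le> x" "x - 1 \<le> real (nat \<lfloor>x\<rfloor>)" if "x \<ge> 0" for x
      using that by linarith+
    have m: "real m \<le> a * L" "a * L - 1 \<le> real m"
      using floor[of "a * L"] a(1) L(4) by (simp_all add: m_def)
    have y: "real y \<le> exp (exp (\<theta> * L))" "exp (exp (\<theta> * L)) \<le> real y + 1"
      using floor[of "exp (exp (\<theta> * L))"] by (simp_all add: y_def)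
    have "exp (exp (\<theta> * L)) \<ge> 1" by simp
    then have y1: "y \<ge> 1" unfolding y_def by (simp add: le_nat_floor)
    \<comment> \<open>Euler's bound converts the size of \<open>y\<close> into prime mass at least
      \<open>\<theta> * L - ln 2\<close>.\<close>
    have "exp (\<theta> * L) = ln (exp (exp (\<theta> * L)))" by simp
    also have "\<dots> \<le> ln (real y + 1)" using y(2) by (subst ln_le_cancel_iff) auto
    also have "\<dots> \<le> 2 * exp (prime_recip_sum y)" by (rule ln_le_exp_prime_recip_sum)
    finally have "\<theta> * L \<le> ln (2 * exp (prime_recip_sum y))"
      by (subst ln_ge_iff) auto
    then have "\<theta> * L - ln 2 \<le> prime_recip_sum y" by (simp add: ln_mult)
    moreover have "real (n * m) * (\<tau> + \<epsilon>) \<le> a * n * (\<tau> + \<epsilon>) * L"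
    proof -
      have "real m * (real n * (\<tau> + \<epsilon>)) \<le> a * L * (real n * (\<tau> + \<epsilon>))"
        using m(1) \<tau> \<epsilon> by (intro mult_right_mono) auto
      then show ?thesis by (simp add: mult_ac)
    qed
    ultimately have mass: "real (n * m) * (\<tau> + \<epsilon>) \<le> prime_recip_sum y - C"
      using L(1) by linarith
    have "real (y ^ (r * m)) \<le> exp (exp (\<theta> * L)) ^ (r * m)"
      using y(1) by (simp add: power_mono)
    also have "\<dots> = exp (real r * real m * exp (\<theta> * L))" by (simp flip: exp_of_nat_mult)
    also have "\<dots> \<le> exp (real r * (a * L) * exp (\<theta> * L))"
      unfolding exp_le_cancel_iff using m(1) by (intro mult_right_mono mult_left_mono) auto
    also have "\<dots> \<le> exp (exp L)" using L(2) by simp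
    also have "\<dots> = real N" by (rule N)
    finally have size: "y ^ (r * m) \<le> N" by linarith
    have "(M * \<tau> ^ r) ^ m \<le> f_lcm k N"
      unfolding M_def using \<tau> \<epsilon> y1 mass size by (intro f_lcm_ge_block_power[OF k, where \<epsilon> = \<epsilon>]) (auto simp: C_def)
    then have f: "exp (real r * real m) \<le> f_lcm k N"
      unfolding M\<tau> by (simp add: mult.commute flip: exp_of_nat_mult)
    have "c * L < real r * real m"
      using L(3) m(2) pos(3) by (smt (verit) mult_left_mono)
    also have "\<dots> \<le> ln (f_lcm k N)" using f by (subst ln_ge_iff) (smt (verit) exp_gt_zero)+
    finally show ?case using L(4) unfolding L_def[symmetric] by (simp add: pos_less_divide_eq)
  qed
qed

text \<open>The upper bound for \<open>f_lcm\<close> has logarithm \<open>\<gamma> * W\<close> up to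
  a logarithmic term in \<open>W\<close>, and Rankin's bound makes \<open>W\<close> at most
  \<open>D * L\<close> up to a constant, with \<open>D\<close> as close to 1 as desired.\<close>

lemma eventually_ln_f_lcm_ratio_less:
  assumes k: "k \<ge> 3" and \<gamma>: "\<gamma> > 0" "\<And>n r. 1 \<le> r \<Longrightarrow> r \<le> n \<Longrightarrow> cosun_ratio k n r \<le> \<gamma>"
    and c: "\<gamma> < c"
  shows "\<forall>\<^sub>F N in sequentially. ln (f_lcm k N) / ln (ln (real N)) < c"
proof -
  \<comment> \<open>\<open>\<gamma> * D\<close> is the midpoint of \<open>\<gamma>\<close> and
    \<open>c\<close>; taking \<open>\<epsilon> = ln D\<close> turns the factor
    \<open>exp \<epsilon>\<close> of Rankin's bound into \<open>D\<close>.\<close>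
  define D where "D = (\<gamma> + c) / (2 * \<gamma>)"
  define \<epsilon> where "\<epsilon> = ln D"
  have D: "D > 1" "\<gamma> * D < c" using \<gamma>(1) c by (auto simp: D_def field_simps)
  then have \<epsilon>: "\<epsilon> > 0" "exp \<epsilon> = D" by (auto simp: \<epsilon>_def)
  \<comment> \<open>Rankin's bound as a function of \<open>L = ln (ln N)\<close>, so that
    \<open>u L / L\<close> tends to \<open>D\<close>.\<close>
  define u where "u = (\<lambda>L. D * (ln (1 + exp L / \<epsilon>) + 2))"
  have "((\<lambda>L. (ln 2 + ln (2 * exp 1 * u L + 3) + \<gamma> * u L) / L) \<longlongrightarrow> \<gamma> * D) at_top"
    unfolding u_def using \<gamma>(1) D(1) \<epsilon>(1) by real_asymp
  then have "\<forall>\<^sub>F L in at_top. (ln 2 + ln (2 * exp 1 * u L + 3) + \<gamma> * u L) / L < c"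
    using D(2) by (rule order_tendstoD)
  then have "\<forall>\<^sub>F L in at_top. (ln 2 + ln (2 * exp 1 * u L + 3) + \<gamma> * u L) / L < c \<and> L > 0"
    by (intro eventually_conj eventually_gt_at_top)
  then have "\<forall>\<^sub>F N in sequentially. (\<lambda>L. (ln 2 + ln (2 * exp 1 * u L + 3) + \<gamma> * u L) / L < c \<and> L > 0)
      (ln (ln (real N)))"
    by (rule eventually_compose_filterlim[OF _ filterlim_ln_ln])
  moreover have "\<forall>\<^sub>F N in sequentially. real N > exp 1"
    by real_asymp
  ultimately show ?thesis
  proof eventually_elim
    case (elim N)
    define L where "L = ln (ln (real N))"
    define W where "W = prime_recip_sum N"
    have L: "(ln 2 + ln (2 * exp 1 * u L + 3) + \<gamma> * u L) / L < c" "L > 0"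
      using elim by (simp_all add: L_def)
    have "real N > 0" using elim(2) by (smt (verit) exp_gt_zero)
    then have "ln (real N) > 1" using elim(2) by (metis exp_less_cancel_iff exp_ln)
    then have expL: "exp L = ln (real N)" unfolding L_def by (intro exp_ln) linarith
    have "real N \<ge> 2" using elim(2) exp_ge_add_one_self[of "1::real"] by linarith
    then have N: "N \<ge> 2" by simp
    have W: "0 \<le> W" "W \<le> u L"
      using prime_recip_sum_nonneg prime_recip_sum_le[OF N \<epsilon>(1)]
      by (auto simp: W_def u_def expL \<epsilon>(2))
    have f: "f_lcm k N \<ge> 1" using f_lcm_ge_one[OF k] N by simp
    have "f_lcm k N \<le> 2 * ((2 * exp 1 * W + 3) * exp (\<gamma> * W))"
      unfolding W_def using \<gamma> by (intro f_lcm_upper[OF k N]) auto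
    also have "\<dots> \<le> 2 * ((2 * exp 1 * u L + 3) * exp (\<gamma> * u L))"
      using W \<gamma>(1) by (intro mult_left_mono mult_mono) auto
    finally have "ln (f_lcm k N) \<le> ln (2 * ((2 * exp 1 * u L + 3) * exp (\<gamma> * u L)))"
      using f by (intro ln_mono) auto
    also have "\<dots> = ln 2 + ln (2 * exp 1 * u L + 3) + \<gamma> * u L"
    proof -
      have "2 * exp 1 * u L + 3 > 0" using W by (intro add_nonneg_pos) auto
      then show ?thesis by (simp add: ln_mult_pos)
    qed
    finally have "ln (f_lcm k N) / L \<le> (ln 2 + ln (2 * exp 1 * u L + 3) + \<gamma> * u L) / L"
      using L(2) by (intro divide_right_mono) auto
    then show ?case using L(1) unfolding L_def[symmetric] by linarith
  qed
qed

text \<open>Boundedness is asserted along with the supremum because \<open>SUP\<close> over an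
  unbounded set of reals carries no information.\<close>

theorem theorem1p1:
  fixes k :: nat
  assumes "k \<ge> 3"
  shows "\<exists>\<gamma>::real.
      (\<lambda>N. ln (f_lcm k N) / ln (ln (real N))) \<longlonglongrightarrow> \<gamma>
    \<and> (\<exists>\<epsilon> :: nat \<Rightarrow> real. \<epsilon> \<longlonglongrightarrow> 0 \<and>
         (\<forall>\<^sub>F N in sequentially. f_lcm k N = ln (real N) powr (\<gamma> + \<epsilon> N)))
    \<and> bdd_above ((\<lambda>(n, r). real r / (exp 1 * real n) * real (M_cosun k n r) powr (1 / real r))
         ` {(n, r). 1 \<le> n \<and> 1 \<le> r \<and> r \<le> n})
    \<and> \<gamma> = (SUP (n, r) \<in> {(n, r). 1 \<le> n \<and> 1 \<le> r \<and> r \<le> n}.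
         real r / (exp 1 * real n) * real (M_cosun k n r) powr (1 / real r))"
proof -
  define I where "I = {(n::nat, r::nat). 1 \<le> n \<and> 1 \<le> r \<and> r \<le> n}"
  define g where "g = (\<lambda>(n, r). cosun_ratio k n r)"
  define \<gamma> where "\<gamma> = (SUP i\<in>I. g i)"
  define q where "q = (\<lambda>N. ln (f_lcm k N) / ln (ln (real N)))"
  have bdd: "bdd_above (g ` I)"
    using cosun_ratio_le_one[OF assms] by (intro bdd_aboveI[of _ 1]) (auto simp: g_def I_def)
  have le: "cosun_ratio k n r \<le> \<gamma>" if "1 \<le> r" "r \<le> n" for n r
    using cSUP_upper[OF _ bdd, of "(n, r)"] that by (simp add: \<gamma>_def g_def I_def)
  \<comment> \<open>The upper estimate divides by \<open>\<gamma>\<close>; the pair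
    \<open>n = r = 1\<close> already has a positive ratio.\<close>
  have pos: "\<gamma> > 0" using le[of 1 1] cosun_ratio_pos[OF assms, of 1 1] by simp
  have lim: "q \<longlonglongrightarrow> \<gamma>"
  proof (rule order_tendstoI)
    fix c assume "c < \<gamma>"
    moreover have "I \<noteq> {}" by (auto simp: I_def)
    ultimately obtain i where i: "i \<in> I" "c < g i"
      unfolding \<gamma>_def using less_cSUP_iff[OF _ bdd] by blast
    obtain n r where "i = (n, r)" by (cases i)
    then show "\<forall>\<^sub>F N in sequentially. c < q N"
      using eventually_less_ln_f_lcm_ratio[OF assms, of r n c] i by (simp add: q_def I_def g_def)
  next
    fix c assume "\<gamma> < c"
    then show "\<forall>\<^sub>F N in sequentially. q N < c"
      unfolding q_def using eventually_ln_f_lcm_ratio_less[OF assms pos le] by blast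
  qed
  \<comment> \<open>The error term is \<open>q N - \<gamma>\<close>, since \<open>f_lcm k N\<close>
    is exactly \<open>ln N powr q N\<close> once \<open>ln (ln N)\<close> is positive.\<close>
  have "(\<lambda>N. q N - \<gamma>) \<longlonglongrightarrow> 0" using tendsto_diff[OF lim tendsto_const[of \<gamma>]] by simp
  moreover have "\<forall>\<^sub>F N in sequentially. f_lcm k N = ln (real N) powr (\<gamma> + (q N - \<gamma>))"
  proof -
    have "\<forall>\<^sub>F N in sequentially. ln (ln (real N)) > 0" "\<forall>\<^sub>F N in sequentially. ln (real N) > 0"
      by real_asymp+
    then show ?thesis using eventually_ge_at_top[of 1]
    proof eventually_elim
      case (elim N)
      then show ?case using f_lcm_ge_one[OF assms, of N] by (simp add: q_def powr_def)
    qed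
  qed
  ultimately have "\<exists>\<epsilon> :: nat \<Rightarrow> real. \<epsilon> \<longlonglongrightarrow> 0 \<and>
      (\<forall>\<^sub>F N in sequentially. f_lcm k N = ln (real N) powr (\<gamma> + \<epsilon> N))" by blast
  then show ?thesis
    using lim bdd \<gamma>_def unfolding q_def g_def I_def cosun_ratio_def by blast
qed

end
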